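(* Let $\mathcal{P}$ be a polygon (possibly with holes), all of whose edges are diffuse reflecting-edges, and let $r \ge 0$ be an integer. If $\mathcal{P}$ can be guarded by $\alpha$ vertex guards without reflections, then $\mathcal{P}$ can be guarded by at most $\left\lceil \frac{\alpha}{1+\lfloor r/4\rfloor}\right\rceil$ vertex guards when each visibility ray is allowed up to $r$ diffuse reflections.
   Context: Two points $x,y$ of $\mathcal{P}$ see each other directly if the relatively open segment $\overline{xy}$ lies in the interior of $\mathcal{P}$. Diffuse reflection: when a visibility ray hits (an interior point of) a reflecting edge, it may be reflected in every direction into the open half-plane on the front (interior) side of that edge, i.e. the angle between incident and reflected ray may take any value in $(0,\pi)$. A point $y$ is seen by a guard $g$ with up to $r$ diffuse reflections if it is seen directly or via a chain of at most $r$ such reflections. A vertex guard is a guard placed at a vertex of $\mathcal{P}$; a set of guards guards $\mathcal{P}$ if every point of $\mathcal{P}$ is seen by some guard. *)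

theory Defs
  imports "HOL-Analysis.Analysis"
begin

text \<open>Points of the plane are complex numbers. A polygon (possibly with holes) is given by
a list of boundary cycles (outer boundary and holes); each cycle is a list of its vertices
in cyclic order.\<close>

definition cycle_edges :: "complex list \<Rightarrow> (complex \<times> complex) set" where
  "cycle_edges c = {(c ! i, c ! ((i + 1) mod length c)) | i. i < length c}"

definition cycle_set :: "complex list \<Rightarrow> complex set" where
  "cycle_set c = (\<Union>(a, b) \<in> cycle_edges c. closed_segment a b)"

text \<open>A simple closed polygonal curve: at least three distinct vertices, no three consecutive
vertices collinear (so every vertex is a genuine corner), and two different edges meet only
in common endpoints.\<close>
definition simple_cycle :: "complex list \<Rightarrow> bool" where
  "simple_cycle c \<longleftrightarrow>
     length c \<ge> 3 \<and> distinct c \<and>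
     (\<forall>i < length c. \<not> collinear {c ! i, c ! ((i + 1) mod length c),
                                       c ! ((i + 2) mod length c)}) \<and>
     (\<forall>i < length c. \<forall>j < length c. i \<noteq> j \<longrightarrow>
        closed_segment (c ! i) (c ! ((i + 1) mod length c)) \<inter>
        closed_segment (c ! j) (c ! ((j + 1) mod length c))
        \<subseteq> {c ! i, c ! ((i + 1) mod length c)} \<inter> {c ! j, c ! ((j + 1) mod length c)})"

definition poly_vertices :: "complex list list \<Rightarrow> complex set" where
  "poly_vertices cs = (\<Union>c \<in> set cs. set c)"

definition poly_edges :: "complex list list \<Rightarrow> (complex \<times> complex) set" where
  "poly_edges cs = (\<Union>c \<in> set cs. cycle_edges c)"

definition polygon_with_holes :: "complex set \<Rightarrow> complex list list \<Rightarrow> bool" where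
  "polygon_with_holes P cs \<longleftrightarrow>
     cs \<noteq> [] \<and> (\<forall>c \<in> set cs. simple_cycle c) \<and>
     (\<forall>i < length cs. \<forall>j < length cs. i \<noteq> j \<longrightarrow> cycle_set (cs ! i) \<inter> cycle_set (cs ! j) = {}) \<and>
     compact P \<and> P = closure (interior P) \<and> connected (interior P) \<and>
     frontier P = (\<Union>c \<in> set cs. cycle_set c)"

definition sees_directly :: "complex set \<Rightarrow> complex \<Rightarrow> complex \<Rightarrow> bool" where
  "sees_directly P x y \<longleftrightarrow> open_segment x y \<subseteq> interior P"

text \<open>Visibility with at most r diffuse reflections (all edges reflecting): a chain
g = q_0, q_1, ..., q_k, q_(k+1) = y with k \<le> r, where each reflection point q_i (1 \<le> i \<le> k)
lies in the relative interior of an edge and consecutive points see each other directly.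
Since the segments lie in the interior of P, incoming and reflected rays lie on the front
side of the edge, and every direction into the open front half-plane is allowed.\<close>
definition sees_refl :: "complex set \<Rightarrow> complex list list \<Rightarrow> nat \<Rightarrow> complex \<Rightarrow> complex \<Rightarrow> bool" where
  "sees_refl P cs r g y \<longleftrightarrow>
     (\<exists>ps :: complex list. length ps \<le> r \<and>
        (\<forall>p \<in> set ps. \<exists>(a, b) \<in> poly_edges cs. p \<in> open_segment a b) \<and>
        (let qs = g # ps @ [y] in
           \<forall>i < length qs - 1. sees_directly P (qs ! i) (qs ! (i + 1))))"

definition guards_refl :: "complex set \<Rightarrow> complex list list \<Rightarrow> nat \<Rightarrow> complex set \<Rightarrow> bool" where
  "guards_refl P cs r G \<longleftrightarrow> (\<forall>y \<in> P. \<exists>g \<in> G. sees_refl P cs r g y)"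

end

(* Call two guards linked if some boundary point seen by the first equals or sees some boundary point
   seen by the second.  A chain through linked vertex guards costs at most four reflections per link:
   the two boundary points, and at most two further ones close to the second guard, where a reflex
   vertex is passed by grazing it.  All guards are connected by links because the visibility graph
   of the boundary points is connected: a point x in general position lies on no line through two
   vertices, so one end of every chord through x is not a vertex, and rotating the chord shows that x
   sees boundary points of a single component only.  In a connected graph with n vertices, some set of at
   most ceil(n / (d + 1)) vertices has all others within distance d; take d = floor(r / 4). *)

theory Submission
  imports Defs
begin

section \<open>Domination in connected graphs\<close>

text \<open>Reflection happens at edge points only, while the guards and the places where sight
  grazes are vertices, so every construction has to stay clear of vertices. This works by stability:
  sight towards an edge point survives small moves of that point along its edge, which leaves room
  for generic positions. The same stability makes each component of edge points relatively open, and
  so the rotating chord can be handled by the connectedness of the interior and of the punctured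
  plane. Guards need not see one another: they jointly see every edge point, so a partition of the
  guards induces two covering classes of edge points, and a link comes from sight between these
  classes.\<close>

text \<open>Greedy choice in the rooted tree with depth \<open>lev\<close> and parent map
  \<open>\<pi>\<close>: pick the \<open>d\<close>-th ancestor \<open>v\<close> of a deepest vertex.
  Nothing below \<open>v\<close> is more than \<open>d\<close> away from it, and its subtree has at
  least \<open>d + 1\<close> vertices, which are removed. A remaining tree of depth at most
  \<open>d\<close> is dominated by its root; this last, possibly small, piece accounts for the
  summand \<open>d\<close> in the bound.\<close>

lemma domination:
  fixes lev :: "'a \<Rightarrow> nat"
  assumes "finite S"
    and "\<And>x. x \<in> S \<Longrightarrow> lev x > 0 \<Longrightarrow> \<pi> x \<in> S \<and> lev (\<pi> x) = lev x - 1"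
    and "\<And>x y. x \<in> S \<Longrightarrow> y \<in> S \<Longrightarrow> lev x = 0 \<Longrightarrow> lev y = 0 \<Longrightarrow> x = y"
  shows "\<exists>D. D \<subseteq> S \<and> card D * (d + 1) \<le> card S + d \<and>
           (\<forall>x\<in>S. \<exists>i\<le>d. i \<le> lev x \<and> (\<pi> ^^ i) x \<in> D)"
  using assms
proof (induction "card S" arbitrary: S rule: less_induct)
  case less
  note fin = less.prems(1) and par = less.prems(2) and root = less.prems(3)
  have iter: "(\<pi> ^^ i) x \<in> S \<and> lev ((\<pi> ^^ i) x) = lev x - i" if "x \<in> S" "i \<le> lev x" for x i
    using that
  proof (induction i)
    case (Suc i)
    then have "(\<pi> ^^ i) x \<in> S" "lev ((\<pi> ^^ i) x) = lev x - i" by auto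
    with par[of "(\<pi> ^^ i) x"] Suc.prems show ?case by auto
  qed auto
  show ?case
  proof (cases "\<exists>x\<in>S. lev x > d")
    case False
    show ?thesis
    proof (cases "S = {}")
      case False
      then obtain x where x: "x \<in> S" by auto
      define r where "r = (\<pi> ^^ lev x) x"
      have r: "r \<in> S" "lev r = 0" using iter[OF x, of "lev x"] by (auto simp: r_def)
      have "(\<pi> ^^ lev y) y = r" if "y \<in> S" for y
        using iter[OF that, of "lev y"] r root by auto
      moreover have "card S \<ge> 1" using fin False by (simp add: Suc_leI card_gt_0_iff)
      ultimately show ?thesis using r \<open>\<not> (\<exists>x\<in>S. lev x > d)\<close>
        by (intro exI[of _ "{r}"]) (auto simp: not_less)
    qed auto
  next
    case True
    then have "S \<noteq> {}" by auto
    define m where "m = Max (lev ` S)"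
    have m_ge: "lev y \<le> m" if "y \<in> S" for y using that fin by (simp add: m_def)
    have "m \<in> lev ` S" using \<open>S \<noteq> {}\<close> fin unfolding m_def by (intro Max_in) auto
    then obtain x where x: "x \<in> S" "lev x = m" by auto
    have "m > d" using True m_ge by (auto intro: less_le_trans)
    define v where "v = (\<pi> ^^ d) x"
    have v: "v \<in> S" "lev v = m - d" using iter[OF x(1), of d] x \<open>m > d\<close> by (auto simp: v_def)
    define T where "T = {y \<in> S. \<exists>i\<le>lev y. (\<pi> ^^ i) y = v}"
    have T_dom: "\<exists>i\<le>d. i \<le> lev y \<and> (\<pi> ^^ i) y = v" if "y \<in> T" for y
    proof -
      from that obtain i where i: "y \<in> S" "i \<le> lev y" "(\<pi> ^^ i) y = v" by (auto simp: T_def)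
      have "m - d = lev y - i" using iter[OF i(1,2)] i(3) v by simp
      then have "i \<le> d" using m_ge[OF i(1)] \<open>m > d\<close> i(2) by linarith
      with i show ?thesis by auto
    qed
    \<comment> \<open>The path from \<open>x\<close> up to \<open>v\<close> supplies the
      \<open>d + 1\<close> members of \<open>T\<close> that pay for \<open>v\<close>.\<close>
    have sub: "(\<lambda>j. (\<pi> ^^ j) x) ` {..d} \<subseteq> T"
    proof
      fix y assume "y \<in> (\<lambda>j. (\<pi> ^^ j) x) ` {..d}"
      then obtain j where j: "j \<le> d" "y = (\<pi> ^^ j) x" by auto
      have "(\<pi> ^^ (d - j)) y = v" using j by (metis v_def funpow_add comp_apply le_add_diff_inverse2)
      moreover have "y \<in> S" "lev y = m - j" using iter[OF x(1), of j] x j \<open>m > d\<close> by auto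
      ultimately show "y \<in> T" using \<open>m > d\<close> j unfolding T_def by (auto intro!: exI[of _ "d - j"])
    qed
    have "inj_on (\<lambda>j. (\<pi> ^^ j) x) {..d}"
    proof (rule inj_onI)
      fix i j assume ij: "i \<in> {..d}" "j \<in> {..d}" "(\<pi> ^^ i) x = (\<pi> ^^ j) x"
      then have "lev x - i = lev x - j"
        using iter[OF x(1), of i] iter[OF x(1), of j] x \<open>m > d\<close> by auto
      with ij x \<open>m > d\<close> show "i = j" by auto
    qed
    then have "card ((\<lambda>j. (\<pi> ^^ j) x) ` {..d}) = d + 1" by (simp add: card_image)
    moreover have "finite T" using fin by (simp add: T_def)
    ultimately have cardT: "d + 1 \<le> card T" using card_mono[OF _ sub] by simp
    have TS: "T \<subseteq> S" by (auto simp: T_def)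
    have card_diff: "card (S - T) = card S - card T"
      using TS \<open>finite T\<close> by (simp add: card_Diff_subset)
    have "card T \<le> card S" using TS fin by (rule card_mono[rotated])
    have "\<exists>D. D \<subseteq> S - T \<and> card D * (d + 1) \<le> card (S - T) + d \<and>
           (\<forall>x\<in>S - T. \<exists>i\<le>d. i \<le> lev x \<and> (\<pi> ^^ i) x \<in> D)"
    proof (rule less.hyps)
      show "card (S - T) < card S" using card_diff cardT \<open>card T \<le> card S\<close> by linarith
      show "finite (S - T)" using fin by simp
      fix y assume y: "y \<in> S - T" "lev y > 0"
      \<comment> \<open>\<open>T\<close> contains all descendants of its members, so what remains is
        still closed under parents.\<close>
      have "\<pi> y \<notin> T"
      proof
        assume "\<pi> y \<in> T"
        then obtain i where "i \<le> lev (\<pi> y)" "(\<pi> ^^ i) (\<pi> y) = v" by (auto simp: T_def)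
        then have "Suc i \<le> lev y" "(\<pi> ^^ Suc i) y = v"
          using par[of y] y by (auto simp: funpow_swap1)
        with y show False by (auto simp: T_def)
      qed
      then show "\<pi> y \<in> S - T \<and> lev (\<pi> y) = lev y - 1" using par[of y] y by auto
    qed (use root in auto)
    then obtain D where D: "D \<subseteq> S - T" "card D * (d + 1) \<le> card (S - T) + d"
      "\<forall>x\<in>S - T. \<exists>i\<le>d. i \<le> lev x \<and> (\<pi> ^^ i) x \<in> D" by blast
    have "finite D" using D(1) fin by (meson finite_Diff finite_subset)
    then have "card (insert v D) * (d + 1) \<le> card D * (d + 1) + (d + 1)"
      by (simp add: card_insert_if)
    also have "\<dots> \<le> card S + d" using D(2) card_diff cardT \<open>card T \<le> card S\<close> by linarith
    finally have "card (insert v D) * (d + 1) \<le> card S + d" .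
    moreover have "\<forall>x\<in>S. \<exists>i\<le>d. i \<le> lev x \<and> (\<pi> ^^ i) x \<in> insert v D"
      using T_dom D(3) by (metis Diff_iff insert_iff)
    ultimately show ?thesis using D(1) v by (intro exI[of _ "insert v D"]) auto
  qed
qed

text \<open>A breadth-first tree from \<open>r\<close> leads to the situation of
  \<open>domination\<close>: \<open>lev\<close> is the distance from \<open>r\<close>, and
  \<open>\<pi>\<close> picks a predecessor on a shortest path. Connectedness is stated by cuts, the
  form in which it is obtained for guards. The dominating \<open>g\<close> is an ancestor of
  \<open>x\<close>, so the path runs from \<open>g\<close> to \<open>x\<close>.\<close>

lemma connected_domination:
  fixes G :: "'a set"
  assumes fin: "finite G" and ne: "G \<noteq> {}"
    and cut: "\<And>A. A \<subseteq> G \<Longrightarrow> A \<noteq> {} \<Longrightarrow> A \<noteq> G \<Longrightarrow> \<exists>a\<in>A. \<exists>b\<in>G - A. (a, b) \<in> R"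
  shows "\<exists>D. D \<subseteq> G \<and> card D * (d + 1) \<le> card G + d \<and>
           (\<forall>x\<in>G. \<exists>g\<in>D. \<exists>i\<le>d. (g, x) \<in> (R \<inter> G \<times> G) ^^ i)"
proof -
  define Q where "Q = R \<inter> G \<times> G"
  from ne obtain r where r: "r \<in> G" by auto
  define A where "A = {x \<in> G. (r, x) \<in> Q\<^sup>*}"
  have "A = G"
  proof (rule ccontr)
    assume "A \<noteq> G"
    then obtain a b where ab: "a \<in> A" "b \<in> G - A" "(a, b) \<in> R"
      using cut[of A] r by (auto simp: A_def)
    then have "(r, b) \<in> Q\<^sup>*"
      by (auto simp: A_def Q_def intro: rtrancl_into_rtrancl)
    with ab show False by (auto simp: A_def)
  qed
  define lev where "lev x = (LEAST n. (r, x) \<in> Q ^^ n)" for x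
  have lev: "(r, x) \<in> Q ^^ lev x" if "x \<in> G" for x
  proof -
    have "\<exists>n. (r, x) \<in> Q ^^ n" using that \<open>A = G\<close> by (auto simp: A_def dest: rtrancl_imp_relpow)
    then show ?thesis unfolding lev_def by (rule LeastI_ex)
  qed
  have "\<exists>y. y \<in> G \<and> lev y = lev x - 1 \<and> (y, x) \<in> Q" if "x \<in> G" "lev x > 0" for x
  proof -
    from lev[OF that(1)] that(2) obtain k y where k: "lev x = Suc k" "(r, y) \<in> Q ^^ k" "(y, x) \<in> Q"
      by (metis gr0_implies_Suc relpow_Suc_E)
    have "y \<in> G" using k by (auto simp: Q_def)
    have "lev y \<le> k" using k(2) by (auto simp: lev_def intro: Least_le)
    moreover have "(r, x) \<in> Q ^^ Suc (lev y)" using lev[OF \<open>y \<in> G\<close>] k(3) by (auto intro: relpow_Suc_I)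
    then have "lev x \<le> Suc (lev y)" unfolding lev_def[of x] by (rule Least_le)
    ultimately show ?thesis using k \<open>y \<in> G\<close> by (intro exI[of _ y]) auto
  qed
  then obtain \<pi> where \<pi>: "\<And>x. x \<in> G \<Longrightarrow> lev x > 0 \<Longrightarrow> \<pi> x \<in> G \<and> lev (\<pi> x) = lev x - 1 \<and> (\<pi> x, x) \<in> Q"
    by metis
  have root: "x = r" if "x \<in> G" "lev x = 0" for x using lev[OF that(1)] that(2) by auto
  have "\<exists>D. D \<subseteq> G \<and> card D * (d + 1) \<le> card G + d \<and>
      (\<forall>x\<in>G. \<exists>i\<le>d. i \<le> lev x \<and> (\<pi> ^^ i) x \<in> D)"
  proof (rule domination[OF fin])
    show "\<pi> x \<in> G \<and> lev (\<pi> x) = lev x - 1" if "x \<in> G" "lev x > 0" for x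
      using \<pi>[OF that] by simp
    show "x = y" if "x \<in> G" "y \<in> G" "lev x = 0" "lev y = 0" for x y
      using root[OF that(1,3)] root[OF that(2,4)] by simp
  qed
  then obtain D where D: "D \<subseteq> G" "card D * (d + 1) \<le> card G + d"
    "\<forall>x\<in>G. \<exists>i\<le>d. i \<le> lev x \<and> (\<pi> ^^ i) x \<in> D"
    by (elim exE conjE)
  have path: "(\<pi> ^^ i) x \<in> G \<and> lev ((\<pi> ^^ i) x) = lev x - i \<and> ((\<pi> ^^ i) x, x) \<in> Q ^^ i"
    if "x \<in> G" "i \<le> lev x" for x i
    using that
  proof (induction i)
    case (Suc i)
    then have IH: "(\<pi> ^^ i) x \<in> G" "lev ((\<pi> ^^ i) x) = lev x - i" "((\<pi> ^^ i) x, x) \<in> Q ^^ i" by auto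
    have "(\<pi> ((\<pi> ^^ i) x), (\<pi> ^^ i) x) \<in> Q" using \<pi>[of "(\<pi> ^^ i) x"] IH Suc.prems by simp
    then have "((\<pi> ^^ Suc i) x, x) \<in> Q ^^ Suc i"
      using relpow_Suc_I2[OF _ IH(3)] by simp
    with IH show ?case using \<pi>[of "(\<pi> ^^ i) x"] Suc.prems by auto
  qed auto
  show ?thesis
  proof (intro exI conjI ballI)
    fix x assume x: "x \<in> G"
    then obtain i where i: "i \<le> d" "i \<le> lev x" "(\<pi> ^^ i) x \<in> D" using D(3) by blast
    with path[OF x i(2)] show "\<exists>g\<in>D. \<exists>i\<le>d. (g, x) \<in> (R \<inter> G \<times> G) ^^ i"
      unfolding Q_def by blast
  qed (use D in auto)
qed

section \<open>Chains of reflections\<close>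

definition edge_points :: "complex list list \<Rightarrow> complex set" where
  "edge_points cs = (\<Union>(a, b) \<in> poly_edges cs. open_segment a b)"

lemma sees_refl_mono:
  assumes "sees_refl P cs r g y" "r \<le> s"
  shows "sees_refl P cs s g y"
  using assms unfolding sees_refl_def by (meson le_trans)

lemma sees_refl_0: "sees_refl P cs 0 g y \<longleftrightarrow> sees_directly P g y"
  unfolding sees_refl_def by (simp add: Let_def)

text \<open>Splitting off the first reflection point replaces list indices by a recursion on
  \<open>r\<close>.\<close>

lemma sees_refl_Suc:
  "sees_refl P cs (Suc r) g y \<longleftrightarrow> sees_directly P g y \<or>
     (\<exists>p\<in>edge_points cs. sees_directly P g p \<and> sees_refl P cs r p y)" (is "?L \<longleftrightarrow> ?R")
proof
  have step: "(let qs = g # (p # ps) @ [y] in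
           \<forall>i < length qs - 1. sees_directly P (qs ! i) (qs ! (i + 1))) \<longleftrightarrow>
        sees_directly P g p \<and> (let qs = p # ps @ [y] in
           \<forall>i < length qs - 1. sees_directly P (qs ! i) (qs ! (i + 1)))" for p ps
    by (simp add: Let_def All_less_Suc2)
  {
    assume ?L
    then obtain ps where ps: "length ps \<le> Suc r"
      "\<forall>p\<in>set ps. \<exists>(a, b)\<in>poly_edges cs. p \<in> open_segment a b"
      "let qs = g # ps @ [y] in \<forall>i < length qs - 1. sees_directly P (qs ! i) (qs ! (i + 1))"
      unfolding sees_refl_def by blast
    show ?R
    proof (cases ps)
      case Nil
      then show ?thesis using ps by (simp add: Let_def)
    next
      case (Cons p ps')
      have "p \<in> edge_points cs" using ps(2) Cons by (auto simp: edge_points_def)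
      moreover have "sees_directly P g p" "sees_refl P cs r p y"
        using ps Cons step[of p ps'] unfolding sees_refl_def by auto
      ultimately show ?thesis by blast
    qed
  }
  assume ?R
  then show ?L
  proof
    assume "sees_directly P g y"
    then show ?L by (metis sees_refl_0 sees_refl_mono zero_le)
  next
    assume "\<exists>p\<in>edge_points cs. sees_directly P g p \<and> sees_refl P cs r p y"
    then obtain p ps where ps: "p \<in> edge_points cs" "sees_directly P g p" "length ps \<le> r"
      "\<forall>p\<in>set ps. \<exists>(a, b)\<in>poly_edges cs. p \<in> open_segment a b"
      "let qs = p # ps @ [y] in \<forall>i < length qs - 1. sees_directly P (qs ! i) (qs ! (i + 1))"
      unfolding sees_refl_def by blast
    have "\<forall>p\<in>set (p # ps). \<exists>(a, b)\<in>poly_edges cs. p \<in> open_segment a b"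
      using ps(1,4) by (auto simp: edge_points_def)
    moreover have "length (p # ps) \<le> Suc r" using ps by simp
    ultimately show ?L using ps(2,5) step[of p ps] unfolding sees_refl_def by blast
  qed
qed

text \<open>The turning point \<open>h\<close> costs nothing: only the first segment of the chain
  leaving \<open>h\<close> is rerouted, by a chain of at most \<open>k\<close> reflections from
  \<open>g\<close> to its end. That end is a reflection point already counted in \<open>l\<close>,
  or \<open>y\<close> itself.\<close>

lemma sees_refl_trans:
  assumes direct: "\<And>z. sees_directly P h z \<Longrightarrow> sees_refl P cs k g z"
    and "sees_refl P cs l h y"
  shows "sees_refl P cs (k + l) g y"
proof -
  \<comment> \<open>Joining at \<open>p\<close> makes \<open>p\<close> a reflection point, hence the
    \<open>Suc\<close>.\<close>
  have append: "sees_refl P cs (Suc (m + n)) g y"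
    if "sees_refl P cs m g p" "p \<in> edge_points cs" "sees_refl P cs n p y" for m n g p
    using that
  proof (induction m arbitrary: g)
    case 0
    then show ?case by (auto simp: sees_refl_0 sees_refl_Suc[of _ _ n])
  next
    case (Suc m)
    from Suc.prems(1) consider "sees_directly P g p"
      | q where "q \<in> edge_points cs" "sees_directly P g q" "sees_refl P cs m q p"
      by (auto simp: sees_refl_Suc)
    then show ?case
    proof cases
      case 1
      then have "sees_refl P cs (Suc n) g y" using Suc.prems by (auto simp: sees_refl_Suc)
      then show ?thesis by (rule sees_refl_mono) simp
    next
      case 2
      then show ?thesis using Suc by (auto simp: sees_refl_Suc[of _ _ "Suc (m + n)"])
    qed
  qed
  show ?thesis
  proof (cases l)
    case 0
    then show ?thesis using assms by (simp add: sees_refl_0)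
  next
    case (Suc l')
    with assms(2) consider "sees_directly P h y"
      | q where "q \<in> edge_points cs" "sees_directly P h q" "sees_refl P cs l' q y"
      by (auto simp: sees_refl_Suc)
    then show ?thesis
    proof cases
      case 1
      then show ?thesis using direct sees_refl_mono by (meson le_add1)
    next
      case 2
      then show ?thesis using append[of k g q l'] direct Suc by simp
    qed
  qed
qed

section \<open>Visibility in polygonal regions\<close>

definition cr :: "complex \<Rightarrow> complex \<Rightarrow> real" where
  "cr u v = Re u * Im v - Im u * Re v"

lemma cr_add_left: "cr (u + w) v = cr u v + cr w v" by (simp add: cr_def algebra_simps)
lemma cr_scaleR_left: "cr (s *\<^sub>R u) v = s * cr u v" by (simp add: cr_def algebra_simps)
lemma cr_scaleR_right: "cr u (s *\<^sub>R v) = s * cr u v" by (simp add: cr_def algebra_simps)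
lemma cr_self: "cr u u = 0" by (simp add: cr_def)

text \<open>As \<open>w\<close> and \<open>d\<close> are linearly independent, a fixed nonzero
  \<open>v\<close> is parallel to \<open>w + s *\<^sub>R d\<close> for at most one \<open>s\<close>;
  finitely many \<open>v\<close> exclude finitely many \<open>s\<close>.\<close>

lemma generic_direction:
  assumes "finite V" "0 < s0" "cr w d \<noteq> 0"
  obtains s where "0 < s" "s < s0" "\<And>v. v \<in> V \<Longrightarrow> v \<noteq> 0 \<Longrightarrow> cr (w + s *\<^sub>R d) v \<noteq> 0"
proof -
  have fin: "finite {s. cr (w + s *\<^sub>R d) v = 0}" if "v \<noteq> 0" for v
  proof (rule finite_subset)
    show "{s. cr (w + s *\<^sub>R d) v = 0} \<subseteq> {- cr w v / cr d v}"
    proof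
      fix s assume "s \<in> {s. cr (w + s *\<^sub>R d) v = 0}"
      then have s: "cr w v + s * cr d v = 0" by (simp add: cr_add_left cr_scaleR_left)
      have "cr d v \<noteq> 0"
      proof
        assume 0: "cr d v = 0"
        with s have 1: "cr w v = 0" by simp
        \<comment> \<open>Cramer's rule for \<open>v\<close> in the basis \<open>w\<close>,
          \<open>d\<close>: both coefficients vanish, so \<open>v\<close> would be 0.\<close>
        have "Re v * cr w d = Re w * cr v d - Re d * cr v w"
             "Im v * cr w d = Im w * cr v d - Im d * cr v w"
          by (simp_all add: cr_def algebra_simps)
        moreover have "cr v d = 0" "cr v w = 0" using 0 1 by (simp_all add: cr_def mult.commute)
        ultimately have "Re v = 0" "Im v = 0" using assms(3) by simp_all
        with that show False by (simp add: complex_eq_iff)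
      qed
      with s show "s \<in> {- cr w v / cr d v}" by (simp add: field_simps)
    qed
  qed simp
  have "finite (\<Union>v\<in>V - {0}. {s. cr (w + s *\<^sub>R d) v = 0})"
    using assms(1) fin by (intro finite_UN_I) auto
  moreover have "infinite {0<..<s0}" using assms(2) by (rule infinite_Ioo)
  ultimately obtain s where "s \<in> {0<..<s0}" "s \<notin> (\<Union>v\<in>V - {0}. {s. cr (w + s *\<^sub>R d) v = 0})"
    by (meson finite_subset subsetI)
  then show thesis using that by auto
qed

lemma closure_rayI:
  fixes x d :: complex
  assumes "e > 0" "\<And>t. 0 < t \<Longrightarrow> t < e \<Longrightarrow> x + t *\<^sub>R d \<in> W"
  shows "x \<in> closure W"
proof -
  have "((\<lambda>t. x + t *\<^sub>R d) \<longlongrightarrow> x + 0 *\<^sub>R d) (at_right 0)" by (intro tendsto_intros)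
  moreover have "eventually (\<lambda>t. x + t *\<^sub>R d \<in> closure W) (at_right (0::real))"
    unfolding eventually_at_right_field using assms closure_subset by blast
  ultimately show ?thesis
    using Lim_in_closed_set[of "closure W" _ "at_right 0"] by fastforce
qed

lemma small_step:
  fixes x y d :: complex
  assumes "x \<in> ball y \<rho>"
  obtains e where "e > 0" "\<And>t. \<bar>t\<bar> < e \<Longrightarrow> x + t *\<^sub>R d \<in> ball y \<rho>"
proof -
  have "((\<lambda>t. x + t *\<^sub>R d) \<longlongrightarrow> x + 0 *\<^sub>R d) (nhds 0)" by (intro tendsto_intros filterlim_ident)
  then have "eventually (\<lambda>t. x + t *\<^sub>R d \<in> ball y \<rho>) (nhds (0::real))"
    using assms by (intro topological_tendstoD) auto
  then show thesis using that unfolding eventually_nhds_metric by (auto simp: dist_real_def)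
qed

text \<open>\<open>A\<close> and \<open>B\<close> are the dual basis of the directions \<open>u\<close> and \<open>v\<close> of the two edges at \<open>b\<close>.\<close>
definition corner :: "complex set \<Rightarrow> complex \<Rightarrow> complex \<Rightarrow> complex \<Rightarrow> complex \<Rightarrow> complex \<Rightarrow> real \<Rightarrow> bool"
  where "corner F b A B u v \<rho> \<longleftrightarrow> \<rho> > 0 \<and> A \<bullet> u = 1 \<and> A \<bullet> v = 0 \<and> B \<bullet> u = 0 \<and> B \<bullet> v = 1 \<and>
    (\<forall>x. x = (A \<bullet> x) *\<^sub>R u + (B \<bullet> x) *\<^sub>R v) \<and>
    (\<forall>w\<in>ball b \<rho>. w \<in> F \<longleftrightarrow> (A \<bullet> (w - b) \<ge> 0 \<and> B \<bullet> (w - b) = 0) \<or> (A \<bullet> (w - b) = 0 \<and> B \<bullet> (w - b) \<ge> 0))"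

lemma corner_swap: "corner F b A B u v \<rho> \<Longrightarrow> corner F b B A v u \<rho>"
  unfolding corner_def by (auto simp: add.commute)

text \<open>\<open>n\<close> is a normal of the edge through \<open>z\<close>.\<close>
definition edge_nbhd :: "complex set \<Rightarrow> complex \<Rightarrow> complex \<Rightarrow> real \<Rightarrow> bool"
  where "edge_nbhd F z n \<rho> \<longleftrightarrow> \<rho> > 0 \<and> n \<noteq> 0 \<and> (\<forall>w\<in>ball z \<rho>. w \<in> F \<longleftrightarrow> n \<bullet> (w - z) = 0)"

text \<open>What the visibility arguments need to know of a polygon: \<open>E\<close> is the union
  of the open edges, \<open>V\<close> the set of vertices, and the boundary is locally a line at
  points of \<open>E\<close> and a pair of rays at points of \<open>V\<close>. Cycles and their
  order no longer occur.\<close>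

locale polygonal_region =
  fixes P E V :: "complex set"
  assumes compact: "compact P"
    and conn: "connected (interior P)"
    and regular: "P = closure (interior P)"
    and frontier_eq: "frontier P = E \<union> V"
    and disjoint: "E \<inter> V = {}"
    and finV: "finite V"
    and edge: "z \<in> E \<Longrightarrow> \<exists>n \<rho>. edge_nbhd (frontier P) z n \<rho>"
    and vertex: "b \<in> V \<Longrightarrow> \<exists>A B u v \<rho>. corner (frontier P) b A B u v \<rho>"
begin

text \<open>Distinctness is demanded because \<open>open_segment x x\<close> is empty, so that a
  point sees itself vacuously. Such trivial sight would spoil the arguments on directions and
  transversality.\<close>

definition vis :: "complex \<Rightarrow> complex \<Rightarrow> bool" where
  "vis x y \<longleftrightarrow> x \<noteq> y \<and> open_segment x y \<subseteq> interior P"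

lemma vis_sym: "vis x y \<Longrightarrow> vis y x"
  by (auto simp: vis_def open_segment_commute)

lemma vis_iff: "vis x y \<longleftrightarrow> x \<noteq> y \<and> (\<forall>t. 0 < t \<longrightarrow> t < 1 \<longrightarrow> x + t *\<^sub>R (y - x) \<in> interior P)"
proof -
  have "(1 - t) *\<^sub>R x + t *\<^sub>R y = x + t *\<^sub>R (y - x)" for t by (simp add: algebra_simps)
  then show ?thesis unfolding vis_def by (auto simp: in_segment subset_iff)
qed

lemma vis_sub:
  assumes "vis x y" "0 < t" "t < 1"
  shows "vis x (x + t *\<^sub>R (y - x))"
  unfolding vis_iff
proof (intro conjI allI impI)
  have "x \<noteq> y" using assms(1) by (simp add: vis_def)
  then show "x \<noteq> x + t *\<^sub>R (y - x)" using assms by simp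
  fix s :: real assume s: "0 < s" "s < 1"
  have "0 < s * t" "s * t < 1" using assms s mult_strict_mono[of s 1 t 1] by auto
  then have "x + (s * t) *\<^sub>R (y - x) \<in> interior P" using assms(1) unfolding vis_iff by blast
  then show "x + s *\<^sub>R (x + t *\<^sub>R (y - x) - x) \<in> interior P" by simp
qed

lemma vis_join:
  assumes "vis x (x + s *\<^sub>R (y - x))" "vis (x + s *\<^sub>R (y - x)) y" "x + s *\<^sub>R (y - x) \<in> interior P"
    and "0 < s" "s < 1"
  shows "vis x y"
  unfolding vis_iff
proof (intro conjI allI impI)
  show "x \<noteq> y" using assms(1) unfolding vis_def by auto
  fix t :: real assume t: "0 < t" "t < 1"
  consider "t < s" | "t = s" | "t > s" by linarith
  then show "x + t *\<^sub>R (y - x) \<in> interior P"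
  proof cases
    case 1
    have "x + (t / s) *\<^sub>R (x + s *\<^sub>R (y - x) - x) \<in> interior P"
      using assms(1) 1 t unfolding vis_iff by (meson divide_less_eq_1_pos divide_pos_pos less_trans)
    then show ?thesis using assms by simp
  next
    case 2
    then show ?thesis using assms by simp
  next
    case 3
    have "x + s *\<^sub>R (y - x) + ((t - s) / (1 - s)) *\<^sub>R (y - (x + s *\<^sub>R (y - x))) \<in> interior P"
      using assms(2) 3 t unfolding vis_iff by simp
    moreover have "x + s *\<^sub>R (y - x) + k *\<^sub>R (y - (x + s *\<^sub>R (y - x))) = x + (s + k * (1 - s)) *\<^sub>R (y - x)" for k
      by (simp add: algebra_simps)
    ultimately show ?thesis using assms by simp
  qed
qed

section \<open>Local cones and the stability of sight\<close>

lemma closedP: "closed P" using compact compact_imp_closed by blast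

lemma interior_disjoint: "interior P \<inter> frontier P = {}"
  by (auto simp: frontier_def)

text \<open>\<open>frontier (interior P)\<close> lies in \<open>frontier P\<close>, so a connected
  set that avoids the latter cannot cross out of the interior.\<close>

lemma connected_subset_interior:
  assumes "connected W" "W \<inter> frontier P = {}" "W \<inter> interior P \<noteq> {}"
  shows "W \<subseteq> interior P"
proof (rule ccontr)
  assume "\<not> W \<subseteq> interior P"
  then have "W \<inter> frontier (interior P) \<noteq> {}"
    using connected_Int_frontier[of W "interior P"] assms by blast
  then show False using assms(2) frontier_interior_subset[of P] by blast
qed

text \<open>The local equations of the boundary, a line or two rays through \<open>x\<close>, are
  invariant under positive scaling from \<open>x\<close>; at a point off the boundary the radius is
  so small that no boundary point is met.\<close>

lemma local_cone_frontier:
  "\<exists>\<rho>>0. \<forall>w\<in>ball x \<rho>. \<forall>t. 0 < t \<longrightarrow> t \<le> 1 \<longrightarrow> w \<noteq> x \<longrightarrow> x + t *\<^sub>R (w - x) \<in> frontier P \<longrightarrow> w \<in> frontier P"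
proof -
  have inball: "x + t *\<^sub>R (w - x) \<in> ball x \<rho>" if "w \<in> ball x \<rho>" "0 < t" "t \<le> 1" for w t \<rho>
  proof -
    have "dist x (x + t *\<^sub>R (w - x)) = t * dist x w" using that by (simp add: dist_norm norm_minus_commute)
    also have "\<dots> \<le> dist x w" using that by (simp add: mult_left_le_one_le)
    finally show ?thesis using that by simp
  qed
  consider "x \<notin> frontier P" | "x \<in> E" | "x \<in> V" using frontier_eq by auto
  then show ?thesis
  proof cases
    case 1
    then obtain e where e: "e > 0" "ball x e \<subseteq> - frontier P"
      by (meson ComplI frontier_closed open_Compl open_contains_ball)
    then show ?thesis using inball by (intro exI[of _ e]) blast
  next
    case 2
    then obtain n \<rho> where "edge_nbhd (frontier P) x n \<rho>" using edge by blast
    then show ?thesis using inball unfolding edge_nbhd_def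
      by (intro exI[of _ \<rho>]) (auto simp: inner_right_distrib)
  next
    case 3
    then obtain A B u v \<rho> where c: "corner (frontier P) x A B u v \<rho>" using vertex by blast
    show ?thesis
    proof (intro exI[of _ \<rho>] conjI ballI allI impI)
      show "\<rho> > 0" using c by (simp add: corner_def)
      fix w t assume w: "w \<in> ball x \<rho>" "0 < t" "t \<le> (1::real)" "x + t *\<^sub>R (w - x) \<in> frontier P"
      then show "w \<in> frontier P"
        using c inball[OF w(1-3)] unfolding corner_def by (auto simp: zero_le_mult_iff)
    qed
  qed
qed

lemma local_cone:
  obtains \<rho> where "\<rho> > 0"
    and "\<And>w t. \<lbrakk>w \<in> ball x \<rho>; w \<in> interior P; w \<noteq> x; 0 < t; t \<le> 1\<rbrakk> \<Longrightarrow> x + t *\<^sub>R (w - x) \<in> interior P"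
proof -
  from local_cone_frontier[of x] obtain \<rho> where \<rho>: "\<rho> > 0"
    "\<forall>w\<in>ball x \<rho>. \<forall>t. 0 < t \<longrightarrow> t \<le> 1 \<longrightarrow> w \<noteq> x \<longrightarrow> x + t *\<^sub>R (w - x) \<in> frontier P \<longrightarrow> w \<in> frontier P"
    by blast
  show ?thesis
  proof (rule that[OF \<rho>(1)])
    fix w t assume w: "w \<in> ball x \<rho>" "w \<in> interior P" "w \<noteq> x" "0 < t" "t \<le> (1::real)"
    let ?W = "(\<lambda>t. x + t *\<^sub>R (w - x)) ` {0<..1}"
    have "connected ?W" by (intro connected_continuous_image continuous_intros) simp
    moreover have "?W \<inter> frontier P = {}" using \<rho>(2) w interior_disjoint by fastforce
    moreover have "x + 1 *\<^sub>R (w - x) \<in> ?W" by (intro imageI) simp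
    then have "?W \<inter> interior P \<noteq> {}" using w by auto
    ultimately have "?W \<subseteq> interior P" by (rule connected_subset_interior)
    then show "x + t *\<^sub>R (w - x) \<in> interior P" using w by auto
  qed
qed

text \<open>A convex \<open>W\<close> guarantees that sight from \<open>x\<close> towards \<open>y\<close> survives moving \<open>x\<close> slightly
  within the closure of \<open>W\<close>, even if \<open>x\<close> lies on the boundary.\<close>
definition end_nbhd :: "complex \<Rightarrow> complex \<Rightarrow> complex set \<Rightarrow> bool" where
  "end_nbhd x y W \<longleftrightarrow> open W \<and> convex W \<and> W \<subseteq> interior P \<and> x \<in> closure W \<and>
     (\<exists>t. 0 < t \<and> t < 1 \<and> x + t *\<^sub>R (y - x) \<in> W)"

lemma end_nbhd_short:
  assumes "end_nbhd x y W"
  obtains s where "0 < s" "s < 1" "\<And>t. 0 < t \<Longrightarrow> t \<le> s \<Longrightarrow> x + t *\<^sub>R (y - x) \<in> W"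
proof -
  obtain s where s: "0 < s" "s < 1" "x + s *\<^sub>R (y - x) \<in> W" using assms by (auto simp: end_nbhd_def)
  have W: "open W" "convex W" "x \<in> closure W" using assms by (auto simp: end_nbhd_def)
  have "x + t *\<^sub>R (y - x) \<in> W" if t: "0 < t" "t \<le> s" for t
  proof (cases "t = s \<or> x = y")
    case False
    have "x + t *\<^sub>R (y - x) = (1 - t / s) *\<^sub>R x + (t / s) *\<^sub>R (x + s *\<^sub>R (y - x))"
      using s by (simp add: algebra_simps)
    then have "x + t *\<^sub>R (y - x) \<in> open_segment x (x + s *\<^sub>R (y - x))"
      using False t s unfolding in_segment by (intro conjI exI[of _ "t / s"]) auto
    then show ?thesis
      using in_interior_closure_convex_segment[of W "x + s *\<^sub>R (y - x)" x] W s
      by (auto simp: interior_open open_segment_commute)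
  qed (use s in auto)
  with s that show thesis by blast
qed

text \<open>\<open>W\<close> is the open cone with apex \<open>x\<close> over a small ball around a
  point \<open>w\<close> of the sight line. With \<open>w\<close> close enough to \<open>x\<close>,
  \<open>local_cone\<close> puts the whole cone into the interior, even when \<open>x\<close> is a
  vertex.\<close>

lemma end_nbhd_exists:
  assumes "vis x y"
  shows "\<exists>W. end_nbhd x y W"
proof -
  obtain \<rho> where \<rho>: "\<rho> > 0"
    "\<And>w t. \<lbrakk>w \<in> ball x \<rho>; w \<in> interior P; w \<noteq> x; 0 < t; t \<le> 1\<rbrakk> \<Longrightarrow> x + t *\<^sub>R (w - x) \<in> interior P"
    using local_cone[of x] by blast
  define s where "s = min (1/2) (\<rho> / (2 * dist x y))"
  have xy: "x \<noteq> y" using assms by (simp add: vis_iff)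
  have s: "0 < s" "s < 1" using \<rho>(1) xy by (auto simp: s_def)
  define w where "w = x + s *\<^sub>R (y - x)"
  have "dist x w = s * dist x y" using s by (simp add: w_def dist_norm norm_minus_commute)
  also have "\<dots> \<le> \<rho> / (2 * dist x y) * dist x y" by (intro mult_right_mono) (auto simp: s_def)
  also have "\<dots> < \<rho>" using xy \<rho>(1) by simp
  finally have "w \<in> ball x \<rho>" by simp
  moreover have "w \<in> interior P" using assms s by (simp add: vis_iff w_def)
  moreover have "w \<in> - {x}" using s xy by (simp add: w_def)
  ultimately have "w \<in> ball x \<rho> \<inter> interior P \<inter> - {x}" by blast
  moreover have "open (ball x \<rho> \<inter> interior P \<inter> - {x})" by (intro open_Int) auto
  ultimately obtain \<eta> where \<eta>: "\<eta> > 0" "ball w \<eta> \<subseteq> ball x \<rho> \<inter> interior P \<inter> - {x}"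
    by (meson open_contains_ball)
  define W where "W = (\<Union>t\<in>{0<..<1}. (\<lambda>v. x + t *\<^sub>R (v - x)) ` ball w \<eta>)"
  have "open W" unfolding W_def
  proof (intro open_UN ballI)
    fix t :: real assume t: "t \<in> {0<..<1}"
    have "(\<lambda>v. x + t *\<^sub>R (v - x)) ` ball w \<eta> = (\<lambda>v. (x - t *\<^sub>R x) + t *\<^sub>R v) ` ball w \<eta>"
      by (simp add: algebra_simps)
    then show "open ((\<lambda>v. x + t *\<^sub>R (v - x)) ` ball w \<eta>)"
      using open_affinity[of "ball w \<eta>" t "x - t *\<^sub>R x"] t by simp
  qed
  moreover have "convex W"
  proof (rule convexI)
    fix p q and a c :: real
    assume "p \<in> W" "q \<in> W" and ac: "0 \<le> a" "0 \<le> c" "a + c = 1"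
    then obtain t1 v1 t2 v2 where
      1: "0 < t1" "t1 < 1" "v1 \<in> ball w \<eta>" "p = x + t1 *\<^sub>R (v1 - x)" and
      2: "0 < t2" "t2 < 1" "v2 \<in> ball w \<eta>" "q = x + t2 *\<^sub>R (v2 - x)"
      unfolding W_def by (auto simp: image_iff)
    \<comment> \<open>A convex combination of points scaled from \<open>x\<close> by
      \<open>t1\<close> and \<open>t2\<close> is a point scaled by the mean \<open>t\<close>, over
      the average \<open>v\<close> of \<open>v1\<close> and \<open>v2\<close> with weights
      proportional to \<open>a * t1\<close> and \<open>c * t2\<close>.\<close>
    define t where "t = a * t1 + c * t2"
    have t0: "t > 0" unfolding t_def using ac 1 2
      by (metis add.commute add_nonneg_pos add_pos_nonneg less_eq_real_def mult_nonneg_nonneg mult_pos_pos zero_less_one not_less)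
    have "t < 1" unfolding t_def using convex_bound_lt[of t1 1 t2 a c] ac 1 2 by simp
    define v where "v = (a * t1 / t) *\<^sub>R v1 + (c * t2 / t) *\<^sub>R v2"
    have "a * t1 / t + c * t2 / t = 1" using t0 by (simp add: t_def add_divide_distrib[symmetric])
    then have "v \<in> ball w \<eta>" unfolding v_def using ac 1 2 t0
      by (intro convexD[OF convex_ball]) auto
    moreover have "a *\<^sub>R p + c *\<^sub>R q = x + t *\<^sub>R (v - x)"
    proof -
      have "t *\<^sub>R v = (a * t1) *\<^sub>R v1 + (c * t2) *\<^sub>R v2"
        using t0 by (simp add: v_def scaleR_right_distrib)
      moreover have "a *\<^sub>R x + c *\<^sub>R x = x" using ac by (simp flip: scaleR_left_distrib)
      ultimately show ?thesis unfolding 1 2 by (simp add: algebra_simps t_def)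
    qed
    ultimately show "a *\<^sub>R p + c *\<^sub>R q \<in> W" unfolding W_def using t0 \<open>t < 1\<close> by (auto intro!: bexI[of _ t] imageI)
  qed
  moreover have "W \<subseteq> interior P"
  proof
    fix p assume "p \<in> W"
    then obtain t v where p: "0 < t" "t < 1" "v \<in> ball w \<eta>" "p = x + t *\<^sub>R (v - x)"
      unfolding W_def by (auto simp: image_iff)
    then have "v \<in> ball x \<rho> \<inter> interior P \<inter> - {x}" using \<eta>(2) by blast
    then show "p \<in> interior P" using \<rho>(2)[of v t] p by simp
  qed
  moreover have wW: "x + t *\<^sub>R (w - x) \<in> W" if "0 < t" "t < 1" for t
    unfolding W_def using that \<eta>(1) by (auto intro!: bexI[of _ t] imageI)
  moreover have "x \<in> closure W"
  proof -
    have "((\<lambda>t. x + t *\<^sub>R (w - x)) \<longlongrightarrow> x + 0 *\<^sub>R (w - x)) (at_right 0)"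
      by (intro tendsto_intros)
    moreover have "eventually (\<lambda>t. x + t *\<^sub>R (w - x) \<in> closure W) (at_right (0::real))"
      unfolding eventually_at_right_field using wW closure_subset by (intro exI[of _ 1]) auto
    ultimately show ?thesis
      using Lim_in_closed_set[of "closure W" _ "at_right 0"] by fastforce
  qed
  moreover have "x + (s / 2) *\<^sub>R (y - x) \<in> W" using wW[of "1/2"] by (simp add: w_def)
  then have "\<exists>t. 0 < t \<and> t < 1 \<and> x + t *\<^sub>R (y - x) \<in> W" using s by (intro exI[of _ "s/2"]) auto
  ultimately show ?thesis unfolding end_nbhd_def by blast
qed

text \<open>The sight line is cut into three. Its compact middle keeps a positive distance from the
  boundary. At each end convexity does the work: a segment from a point of \<open>closure W\<close>
  to a point of the open set \<open>W\<close> runs inside \<open>W\<close>, so the moved end may lie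
  on the boundary.\<close>

lemma vis_perturb:
  assumes "vis x y" "end_nbhd x y W" "end_nbhd y x U"
  obtains \<epsilon> where "\<epsilon> > 0"
    "\<And>x' y'. \<lbrakk>x' \<in> closure W; y' \<in> closure U; dist x' x < \<epsilon>; dist y' y < \<epsilon>\<rbrakk> \<Longrightarrow> vis x' y'"
proof -
  obtain s0 where s0: "0 < s0" "s0 < 1" "\<And>t. 0 < t \<Longrightarrow> t \<le> s0 \<Longrightarrow> x + t *\<^sub>R (y - x) \<in> W"
    using end_nbhd_short[OF assms(2)] by blast
  obtain t0 where t0: "0 < t0" "t0 < 1" "\<And>t. 0 < t \<Longrightarrow> t \<le> t0 \<Longrightarrow> y + t *\<^sub>R (x - y) \<in> U"
    using end_nbhd_short[OF assms(3)] by blast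
  \<comment> \<open>The caps \<open>1/3\<close> guarantee \<open>s < t\<close>, leaving a middle
    part.\<close>
  define s where "s = min s0 (1/3)"
  define t where "t = 1 - min t0 (1/3)"
  have st: "0 < s" "s < t" "t < 1" using s0 t0 by (auto simp: s_def t_def)
  define L where "L r = x + r *\<^sub>R (y - x)" for r
  have Ls: "L s \<in> W" using s0 by (simp add: L_def s_def)
  have "L t = y + (1 - t) *\<^sub>R (x - y)" by (simp add: L_def algebra_simps)
  then have Lt: "L t \<in> U" using t0 by (simp add: t_def)
  have W: "open W" "convex W" "W \<subseteq> interior P" using assms(2) by (auto simp: end_nbhd_def)
  have U: "open U" "convex U" "U \<subseteq> interior P" using assms(3) by (auto simp: end_nbhd_def)
  obtain e1 where e1: "e1 > 0" "ball (L s) e1 \<subseteq> W" using W Ls open_contains_ball by blast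
  obtain e2 where e2: "e2 > 0" "ball (L t) e2 \<subseteq> U" using U Lt open_contains_ball by blast
  have "compact (L ` {s..t})" unfolding L_def
    by (intro compact_continuous_image continuous_intros) simp
  moreover have "L ` {s..t} \<subseteq> interior P" using assms(1) st by (auto simp: vis_iff L_def)
  ultimately obtain e3 where e3: "e3 > 0" "(\<Union>p\<in>L ` {s..t}. ball p e3) \<subseteq> interior P"
    using compact_subset_open_imp_ball_epsilon_subset[of "L ` {s..t}" "interior P"] by auto
  have xy: "x \<noteq> y" using assms(1) by (simp add: vis_iff)
  \<comment> \<open>The bound \<open>dist x y / 2\<close> keeps \<open>x'\<close> and
    \<open>y'\<close> distinct.\<close>
  define e where "e = min (min e1 e2) (min e3 (dist x y / 2))"
  have e: "e > 0" using e1 e2 e3 xy by (simp add: e_def)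
  show thesis
  proof (rule that[OF e])
    fix x' y' assume xy': "x' \<in> closure W" "y' \<in> closure U" "dist x' x < e" "dist y' y < e"
    define M where "M r = x' + r *\<^sub>R (y' - x')" for r
    have near: "dist (L r) (M r) < e" if "0 \<le> r" "r \<le> 1" for r
    proof -
      have "L r - M r = (1 - r) *\<^sub>R (x - x') + r *\<^sub>R (y - y')" by (simp add: L_def M_def algebra_simps)
      then have "dist (L r) (M r) \<le> (1 - r) * norm (x - x') + r * norm (y - y')"
        using that by (auto simp: dist_norm intro: order_trans[OF norm_triangle_ineq])
      also have "\<dots> < e" using that xy' convex_bound_lt[of "norm (x - x')" e "norm (y - y')" "1 - r" r]
        by (simp add: dist_norm norm_minus_commute)
      finally show ?thesis .
    qed
    have "M s \<in> ball (L s) e1" using near[of s] st by (simp add: e_def)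
    then have Ms: "M s \<in> W" using e1 by blast
    have "M t \<in> ball (L t) e2" using near[of t] st by (simp add: e_def)
    then have Mt: "M t \<in> U" using e2 by blast
    show "vis x' y'" unfolding vis_iff
    proof (intro conjI allI impI)
      show "x' \<noteq> y'"
      proof
        assume "x' = y'"
        then have "dist x y < e + e" using xy'(3,4) dist_triangle_less_add[of x x' e y e]
          by (simp add: dist_commute)
        then show False by (simp add: e_def)
      qed
      fix r :: real assume r: "0 < r" "r < 1"
      consider "r < s" | "s \<le> r" "r \<le> t" | "t < r" by linarith
      then have "M r \<in> interior P"
      proof cases
        case 1
        have "M r = (1 - r / s) *\<^sub>R x' + (r / s) *\<^sub>R M s"
          using st by (simp add: algebra_simps M_def)
        then have "M r \<in> open_segment x' (M s)"
          using 1 r st \<open>x' \<noteq> y'\<close> unfolding in_segment by (intro conjI exI[of _ "r / s"]) (auto simp: M_def)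
        then show ?thesis
          using in_interior_closure_convex_segment[of W "M s" x'] W xy' Ms
          by (auto simp: interior_open open_segment_commute)
      next
        case 2
        then have "M r \<in> ball (L r) e3" using near[of r] st by (simp add: e_def)
        then show ?thesis using e3(2) 2 by (metis UN_I atLeastAtMost_iff imageI subset_eq)
      next
        case 3
        have "M r = (1 - (1 - r) / (1 - t)) *\<^sub>R y' + ((1 - r) / (1 - t)) *\<^sub>R M t"
        proof -
          have M: "M q = y' + (1 - q) *\<^sub>R (x' - y')" for q by (simp add: M_def algebra_simps)
          have "(1 - k) *\<^sub>R y' + k *\<^sub>R M t = y' + (k * (1 - t)) *\<^sub>R (x' - y')" for k
            by (simp add: M algebra_simps)
          then show ?thesis using st by (simp add: M)
        qed
        then have "M r \<in> open_segment y' (M t)"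
          using 3 r st \<open>x' \<noteq> y'\<close> unfolding in_segment
          by (intro conjI exI[of _ "(1 - r) / (1 - t)"]) (auto simp: M_def algebra_simps)
        then show ?thesis
          using in_interior_closure_convex_segment[of U "M t" y'] U xy' Mt
          by (auto simp: interior_open open_segment_commute)
      qed
      then show "x' + r *\<^sub>R (y' - x') \<in> interior P" by (simp add: M_def)
    qed
  qed
qed

section \<open>Sight towards edge points\<close>

lemma frontier_subset: "frontier P \<subseteq> P"
  using closedP by (simp add: frontier_subset_closed)

lemma E_near: "z \<in> E \<Longrightarrow> \<exists>\<eta>>0. \<forall>w\<in>ball z \<eta>. w \<in> frontier P \<longrightarrow> w \<in> E"
proof -
  assume "z \<in> E"
  then have "z \<in> - V" "open (- V)" using disjoint finV by (auto simp: finite_imp_closed)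
  then obtain \<eta> where "\<eta> > 0" "ball z \<eta> \<subseteq> - V" by (meson open_contains_ball)
  then show ?thesis using frontier_eq by blast
qed

text \<open>A sight line parallel to the edge would run inside the boundary near
  \<open>z\<close>.\<close>

lemma edge_transversal:
  assumes "edge_nbhd (frontier P) z n \<rho>" "vis z y"
  shows "n \<bullet> (y - z) \<noteq> 0"
proof
  assume 0: "n \<bullet> (y - z) = 0"
  have "z \<in> ball z \<rho>" using assms by (simp add: edge_nbhd_def)
  then obtain e where e: "e > 0" "\<And>t. \<bar>t\<bar> < e \<Longrightarrow> z + t *\<^sub>R (y - z) \<in> ball z \<rho>"
    using small_step[of z z \<rho> "y - z"] by blast
  define t where "t = min (e/2) (1/2)"
  have t: "0 < t" "t < 1" "t < e" using e by (auto simp: t_def)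
  have "z + t *\<^sub>R (y - z) \<in> frontier P"
    using assms(1) e(2)[of t] t 0 unfolding edge_nbhd_def by (auto simp: inner_right_distrib)
  moreover have "z + t *\<^sub>R (y - z) \<in> interior P" using assms(2) t by (simp add: vis_iff)
  ultimately show False using interior_disjoint by blast
qed

text \<open>The half disc on the side of \<open>y\<close> serves as \<open>W\<close>. Its closure
  contains the piece of the edge around \<open>z\<close>, so an edge point may be moved along its
  edge without losing sight.\<close>

lemma edge_end:
  assumes "z \<in> E" "vis z y"
  obtains W \<eta> where "end_nbhd z y W" "\<eta> > 0" "\<And>w. w \<in> E \<Longrightarrow> dist w z < \<eta> \<Longrightarrow> w \<in> closure W"
proof -
  from edge[OF assms(1)] obtain n0 \<rho> where n0: "edge_nbhd (frontier P) z n0 \<rho>" by blast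
  \<comment> \<open>The normal is oriented towards \<open>y\<close>.\<close>
  define n where "n = sgn (n0 \<bullet> (y - z)) *\<^sub>R n0"
  have nz: "n0 \<bullet> (y - z) \<noteq> 0" using edge_transversal[OF n0 assms(2)] .
  have n: "edge_nbhd (frontier P) z n \<rho>" using n0 nz
    by (auto simp: edge_nbhd_def n_def sgn_zero_iff)
  have pos: "n \<bullet> (y - z) > 0" using nz by (simp add: n_def sgn_real_def)
  have \<rho>: "\<rho> > 0" using n by (simp add: edge_nbhd_def)
  define W where "W = {w. n \<bullet> w > n \<bullet> z} \<inter> ball z \<rho>"
  have W: "open W" "convex W" unfolding W_def
    by (auto intro!: open_Int convex_Int convex_halfspace_gt open_halfspace_gt)
  have cl: "w \<in> closure W" if w: "w \<in> ball z \<rho>" "n \<bullet> (w - z) = 0" for w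
  proof -
    obtain e where e: "e > 0" "\<And>t. \<bar>t\<bar> < e \<Longrightarrow> w + t *\<^sub>R n \<in> ball z \<rho>"
      using small_step[OF w(1)] by blast
    show ?thesis
    proof (rule closure_rayI[OF e(1)])
      fix t :: real assume t: "0 < t" "t < e"
      have "n \<bullet> n > 0" using n by (simp add: edge_nbhd_def)
      then show "w + t *\<^sub>R n \<in> W" using e(2)[of t] t w(2)
        by (simp add: W_def inner_right_distrib inner_diff_right)
    qed
  qed
  have zb: "z \<in> ball z \<rho>" using \<rho> by simp
  obtain e where e: "e > 0" "\<And>t. \<bar>t\<bar> < e \<Longrightarrow> z + t *\<^sub>R (y - z) \<in> ball z \<rho>"
    using small_step[OF zb] by blast
  define t where "t = min (e/2) (1/2)"
  have t: "0 < t" "t < 1" "t < e" using e by (auto simp: t_def)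
  have inW: "z + t *\<^sub>R (y - z) \<in> W" using e(2)[of t] t pos by (simp add: W_def inner_right_distrib)
  have "W \<inter> frontier P = {}" using n unfolding W_def edge_nbhd_def by (auto simp: inner_diff_right)
  moreover have "z + t *\<^sub>R (y - z) \<in> interior P" using assms(2) t by (simp add: vis_iff)
  ultimately have "W \<subseteq> interior P"
    using connected_subset_interior[of W] W inW convex_connected by blast
  then have "end_nbhd z y W" unfolding end_nbhd_def using W inW t cl[OF zb] by auto
  moreover have "w \<in> closure W" if "w \<in> E" "dist w z < \<rho>" for w
  proof (rule cl)
    show "w \<in> ball z \<rho>" using that by (simp add: dist_commute)
    then show "n \<bullet> (w - z) = 0" using n that frontier_eq unfolding edge_nbhd_def by blast
  qed
  ultimately show thesis using that \<rho> by blast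
qed

lemma vis_near:
  assumes "vis b y" "end_nbhd b y W"
  obtains \<epsilon> where "\<epsilon> > 0" "\<And>q. q \<in> closure W \<Longrightarrow> dist q b < \<epsilon> \<Longrightarrow> vis q y"
proof -
  obtain U where U: "end_nbhd y b U" using end_nbhd_exists vis_sym assms by blast
  from vis_perturb[OF assms U] obtain \<epsilon> where \<epsilon>: "\<epsilon> > 0"
    "\<And>x' y'. \<lbrakk>x' \<in> closure W; y' \<in> closure U; dist x' b < \<epsilon>; dist y' y < \<epsilon>\<rbrakk> \<Longrightarrow> vis x' y'"
    by metis
  then show thesis using that U by (auto simp: end_nbhd_def)
qed

lemma vis_near_edge:
  assumes "vis b h" "end_nbhd b h W" "h \<in> E"
  obtains \<epsilon> where "\<epsilon> > 0"
    "\<And>q z. \<lbrakk>q \<in> closure W; z \<in> E; dist q b < \<epsilon>; dist z h < \<epsilon>\<rbrakk> \<Longrightarrow> vis q z"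
proof -
  obtain U \<eta> where U: "end_nbhd h b U" "\<eta> > 0" "\<And>w. w \<in> E \<Longrightarrow> dist w h < \<eta> \<Longrightarrow> w \<in> closure U"
    using edge_end[OF assms(3)] vis_sym assms by metis
  from vis_perturb[OF assms(1,2) U(1)] obtain \<epsilon> where \<epsilon>: "\<epsilon> > 0"
    "\<And>x' y'. \<lbrakk>x' \<in> closure W; y' \<in> closure U; dist x' b < \<epsilon>; dist y' h < \<epsilon>\<rbrakk> \<Longrightarrow> vis x' y'"
    by metis
  show thesis by (rule that[of "min \<epsilon> \<eta>"]) (use \<epsilon> U in auto)
qed

text \<open>The viewpoint stays fixed and only \<open>z\<close> moves along its edge. Thus the edge
  points seen from \<open>x\<close> form a relatively open subset of \<open>E\<close>, for interior
  points and vertices \<open>x\<close> alike.\<close>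

lemma vis_edge:
  assumes "vis x z" "z \<in> E"
  obtains \<eta> where "\<eta> > 0" "\<And>w. w \<in> E \<Longrightarrow> dist w z < \<eta> \<Longrightarrow> vis x w"
proof -
  obtain W where W: "end_nbhd x z W" using end_nbhd_exists assms by blast
  from vis_near_edge[OF assms(1) W assms(2)] obtain \<epsilon> where
    "\<epsilon> > 0" "\<And>q w. \<lbrakk>q \<in> closure W; w \<in> E; dist q x < \<epsilon>; dist w z < \<epsilon>\<rbrakk> \<Longrightarrow> vis q w" by metis
  then show thesis using that W by (auto simp: end_nbhd_def)
qed

lemma vis_interior:
  assumes "vis x z" "x \<in> interior P"
  obtains \<eta> where "\<eta> > 0" "\<And>w. dist w x < \<eta> \<Longrightarrow> vis w z"
proof -
  obtain e where e: "e > 0" "ball x e \<subseteq> interior P" using assms(2) open_contains_ball by blast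
  have xb: "x \<in> ball x e" using e by simp
  obtain e' where e': "e' > 0" "\<And>t. \<bar>t\<bar> < e' \<Longrightarrow> x + t *\<^sub>R (z - x) \<in> ball x e"
    using small_step[OF xb] by blast
  have "x + min (e'/2) (1/2) *\<^sub>R (z - x) \<in> ball x e" using e' by (intro e'(2)) auto
  then have "end_nbhd x z (ball x e)" unfolding end_nbhd_def using e e' xb closure_subset
    by (auto intro!: exI[of _ "min (e'/2) (1/2)"])
  from vis_near[OF assms(1) this] obtain \<epsilon> where
    "\<epsilon> > 0" "\<And>q. q \<in> closure (ball x e) \<Longrightarrow> dist q x < \<epsilon> \<Longrightarrow> vis q z" by metis
  then show thesis using that[of "min e \<epsilon>"] e closure_subset[of "ball x e"]
    by (auto simp: dist_commute subset_iff)
qed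

text \<open>The line of the edge is met at the parameter \<open>T d\<close>, a quotient that depends
  continuously on \<open>d\<close> near \<open>z - x\<close> because the ray towards
  \<open>z\<close> is transversal to the edge.\<close>

lemma ray_hits_edge:
  assumes "z \<in> E" "edge_nbhd (frontier P) z n \<rho>" "n \<bullet> (z - x) \<noteq> 0" "\<eta> > 0"
  obtains \<epsilon> where "\<epsilon> > 0"
    "\<And>d. dist d (z - x) < \<epsilon> \<Longrightarrow> \<exists>t. \<bar>t - 1\<bar> < \<eta> \<and> x + t *\<^sub>R d \<in> E \<and> dist (x + t *\<^sub>R d) z < \<eta>"
proof -
  obtain r where r: "r > 0" "\<And>w. w \<in> ball z r \<Longrightarrow> w \<in> frontier P \<Longrightarrow> w \<in> E" using E_near[OF assms(1)] by blast
  define T where "T d = (n \<bullet> (z - x)) / (n \<bullet> d)" for d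
  define N where "N = nhds (z - x)"
  have id: "((\<lambda>d. d) \<longlongrightarrow> z - x) N" unfolding N_def by (rule filterlim_ident)
  have "(T \<longlongrightarrow> (n \<bullet> (z - x)) / (n \<bullet> (z - x))) N" unfolding T_def
    using assms(3) by (intro tendsto_intros id) auto
  then have T1: "(T \<longlongrightarrow> 1) N" using assms(3) by simp
  have "((\<lambda>d. x + T d *\<^sub>R d) \<longlongrightarrow> x + 1 *\<^sub>R (z - x)) N" by (intro tendsto_intros id T1)
  then have lim: "((\<lambda>d. x + T d *\<^sub>R d) \<longlongrightarrow> z) N" by simp
  have \<rho>: "\<rho> > 0" using assms(2) by (simp add: edge_nbhd_def)
  have "eventually (\<lambda>d. dist (T d) 1 < \<eta>) N" using T1 assms(4) by (rule tendstoD)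
  moreover have "eventually (\<lambda>d. dist (x + T d *\<^sub>R d) z < min \<eta> (min r \<rho>)) N"
    using lim assms(4) r \<rho> by (intro tendstoD) auto
  moreover have "((\<lambda>d. n \<bullet> d) \<longlongrightarrow> n \<bullet> (z - x)) N" by (intro tendsto_intros id)
  then have "eventually (\<lambda>d. n \<bullet> d \<noteq> 0) N" using assms(3) by (rule tendsto_imp_eventually_ne)
  ultimately have "eventually (\<lambda>d. \<exists>t. \<bar>t - 1\<bar> < \<eta> \<and> x + t *\<^sub>R d \<in> E \<and> dist (x + t *\<^sub>R d) z < \<eta>) N"
  proof eventually_elim
    case (elim d)
    have "n \<bullet> (x + T d *\<^sub>R d - z) = T d * (n \<bullet> d) - n \<bullet> (z - x)"
      by (simp add: inner_diff_right inner_right_distrib)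
    also have "\<dots> = 0" using elim by (simp add: T_def)
    finally have "x + T d *\<^sub>R d \<in> frontier P"
      using assms(2) elim unfolding edge_nbhd_def by (auto simp: dist_commute)
    then show ?case using elim r(2) by (intro exI[of _ "T d"]) (auto simp: dist_real_def dist_commute)
  qed
  then show thesis using that unfolding N_def eventually_nhds_metric by blast
qed

text \<open>A ray that starts off inside must leave the bounded set \<open>P\<close>, so the
  parameters of its boundary points have an infimum, and it is attained.\<close>

lemma first_hit:
  assumes "d \<noteq> 0" "e > 0" "\<And>t. 0 < t \<Longrightarrow> t < e \<Longrightarrow> x + t *\<^sub>R d \<in> interior P"
  obtains t where "t > 0" "x + t *\<^sub>R d \<in> frontier P" "vis x (x + t *\<^sub>R d)"
proof -
  define L where "L t = x + t *\<^sub>R d" for t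
  \<comment> \<open>Cutting off below \<open>e/2\<close> discards the start \<open>x\<close>, which
    may itself lie on the boundary; no other hit is lost.\<close>
  define T where "T = {e/2..} \<inter> L -` frontier P"
  have cont: "continuous_on A L" for A unfolding L_def by (intro continuous_intros)
  have inside: "L ` {0<..<s} \<subseteq> interior P" if "s > 0" "\<And>t. t \<in> T \<Longrightarrow> s \<le> t" for s
  proof (rule connected_subset_interior)
    show "connected (L ` {0<..<s})" by (intro connected_continuous_image cont) simp
    show "L ` {0<..<s} \<inter> frontier P = {}"
    proof (rule ccontr)
      assume "\<not> ?thesis"
      then obtain t where t: "0 < t" "t < s" "L t \<in> frontier P" by auto
      then have "t \<ge> e" using assms(3) interior_disjoint unfolding L_def by (meson disjoint_iff not_le)
      then show False using that(2)[of t] t assms(2) by (auto simp: T_def)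
    qed
    have "min (s/2) (e/2) \<in> {0<..<s}" "L (min (s/2) (e/2)) \<in> interior P"
      using that assms(2) by (auto simp: L_def intro!: assms(3))
    then show "L ` {0<..<s} \<inter> interior P \<noteq> {}" by blast
  qed
  have "T \<noteq> {}"
  proof
    assume "T = {}"
    obtain r where r: "\<And>p. p \<in> P \<Longrightarrow> norm p \<le> r"
      using compact compact_imp_bounded bounded_iff by metis
    have "x + (e/2) *\<^sub>R d \<in> P" using assms interior_subset by (metis field_sum_of_halves half_gt_zero less_add_same_cancel1 subsetD)
    then have "r \<ge> 0" using r norm_ge_zero order_trans by blast
    \<comment> \<open>Far enough out that \<open>norm (L t)\<close> exceeds the bound
      \<open>r\<close> by at least 1.\<close>
    define t where "t = (r + norm x + 1) / norm d"
    have "t > 0" using \<open>r \<ge> 0\<close> assms(1) by (auto simp: t_def intro!: divide_pos_pos add_nonneg_pos)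
    then have "L ` {0<..<t + 1} \<subseteq> interior P" using inside[of "t + 1"] \<open>T = {}\<close> by simp
    moreover have "L t \<in> L ` {0<..<t + 1}" using \<open>t > 0\<close> by simp
    ultimately have "L t \<in> P" using interior_subset[of P] by blast
    then have "norm (L t) \<le> r" by (rule r)
    moreover have "norm (t *\<^sub>R d) = r + norm x + 1" using assms(1) \<open>r \<ge> 0\<close> by (simp add: t_def)
    then have "norm (L t) \<ge> r + 1" unfolding L_def using norm_triangle_ineq2[of "t *\<^sub>R d" "- x"]
      by (simp add: add.commute)
    ultimately show False by simp
  qed
  moreover have "closed T" unfolding T_def
    by (intro closed_Int closed_vimage[OF frontier_closed] cont) simp
  moreover have bdd: "bdd_below T" unfolding T_def by auto
  ultimately have InfT: "Inf T \<in> T" by (intro closed_contains_Inf)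
  then have t0: "Inf T > 0" "L (Inf T) \<in> frontier P" using assms(2) by (auto simp: T_def)
  have "L ` {0<..<Inf T} \<subseteq> interior P" using inside t0(1) bdd by (simp add: cInf_lower)
  then have ins: "L t \<in> interior P" if "0 < t" "t < Inf T" for t using that by auto
  have "vis x (L (Inf T))" unfolding vis_iff
  proof (intro conjI allI impI)
    show "x \<noteq> L (Inf T)" using t0 assms(1) by (simp add: L_def)
    fix t :: real assume "0 < t" "t < 1"
    then show "x + t *\<^sub>R (L (Inf T) - x) \<in> interior P" using ins[of "t * Inf T"] t0 by (simp add: L_def)
  qed
  then show thesis using that t0 unfolding L_def by blast
qed

text \<open>Choose an interior point \<open>w\<close> in the local cone at \<open>x\<close> and turn
  the ray towards it slightly, so that it is parallel to no nonzero \<open>v - x\<close>. Its first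
  boundary point then cannot be a vertex.\<close>

lemma sees_edge:
  assumes "x \<in> P"
  shows "\<exists>m\<in>E. vis x m"
proof -
  obtain \<rho> where \<rho>: "\<rho> > 0"
    "\<And>w t. \<lbrakk>w \<in> ball x \<rho>; w \<in> interior P; w \<noteq> x; 0 < t; t \<le> 1\<rbrakk> \<Longrightarrow> x + t *\<^sub>R (w - x) \<in> interior P"
    using local_cone[of x] by blast
  define U where "U = ball x \<rho> \<inter> interior P"
  have "x \<in> closure (interior P)" using assms regular by auto
  then have "U \<noteq> {}" using \<rho>(1) unfolding U_def closure_approachable
    by (metis IntI dist_commute emptyE mem_ball)
  moreover have "open U" by (auto simp: U_def)
  ultimately have "U - {x} \<noteq> {}" by (metis Diff_eq_empty_iff not_open_singleton subset_singleton_iff)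
  moreover have "open (U - {x})" using \<open>open U\<close> by (rule open_delete)
  ultimately obtain w \<eta> where w: "w \<in> U - {x}" "\<eta> > 0" "ball w \<eta> \<subseteq> U - {x}"
    by (meson all_not_in_conv open_contains_ball)
  \<comment> \<open>A quarter turn of \<open>w - x\<close>, hence linearly independent of
    it.\<close>
  define d where "d = \<i> * (w - x)"
  have "cr (w - x) d = (norm (w - x))\<^sup>2" 
    unfolding cmod_power2 by (simp add: d_def cr_def power2_eq_square algebra_simps)
  then have crn: "cr (w - x) d \<noteq> 0" using w(1) by simp
  have "w \<in> ball w \<eta>" using w by simp
  then obtain e where e: "e > 0" "\<And>t. \<bar>t\<bar> < e \<Longrightarrow> w + t *\<^sub>R d \<in> ball w \<eta>"
    using small_step[of w w \<eta> d] by blast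
  have "finite ((\<lambda>v. v - x) ` V)" using finV by simp
  then obtain s where s: "0 < s" "s < e"
    "\<And>v. v \<in> (\<lambda>v. v - x) ` V \<Longrightarrow> v \<noteq> 0 \<Longrightarrow> cr (w - x + s *\<^sub>R d) v \<noteq> 0"
    using generic_direction[OF _ e(1) crn] by metis
  define w' where "w' = w + s *\<^sub>R d"
  have "w' \<in> U - {x}" using e(2)[of s] s w(3) unfolding w'_def by auto
  then have "w' - x \<noteq> 0" "\<And>t. 0 < t \<Longrightarrow> t < 1 \<Longrightarrow> x + t *\<^sub>R (w' - x) \<in> interior P"
    using \<rho>(2)[of w'] by (auto simp: U_def)
  then obtain t where t: "t > 0" "x + t *\<^sub>R (w' - x) \<in> frontier P" "vis x (x + t *\<^sub>R (w' - x))"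
    using first_hit[of "w' - x" 1 x] by (metis zero_less_one)
  have "x + t *\<^sub>R (w' - x) \<notin> V"
  proof
    assume v: "x + t *\<^sub>R (w' - x) \<in> V"
    have eq: "w - x + s *\<^sub>R d = w' - x" by (simp add: w'_def)
    have "t *\<^sub>R (w' - x) \<in> (\<lambda>v. v - x) ` V" using v by (intro image_eqI[OF _ v]) simp
    then have "cr (w' - x) (t *\<^sub>R (w' - x)) \<noteq> 0"
      using s(3)[of "t *\<^sub>R (w' - x)"] t(1) \<open>w' - x \<noteq> 0\<close> unfolding eq by simp
    then show False by (simp add: cr_scaleR_right cr_self)
  qed
  then show ?thesis using t frontier_eq by blast
qed

subsection \<open>Connectedness of the visibility graph of the boundary\<close>

lemma sees_point_of_interior:
  assumes "z \<in> E"
  obtains x where "x \<in> interior P" "vis x z"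
proof -
  have "z \<in> P" using assms frontier_eq frontier_subset by blast
  then obtain m where m: "vis z m" using sees_edge by blast
  have "vis z (z + (1/2) *\<^sub>R (m - z))" using vis_sub[OF m, of "1/2"] by simp
  moreover have "z + (1/2) *\<^sub>R (m - z) \<in> interior P" using m by (simp add: vis_iff)
  ultimately show thesis using that vis_sym by blast
qed

text \<open>Some edge point \<open>m\<close> sees \<open>z\<close>, and by separation
  \<open>m\<close> belongs to \<open>S\<close>. All edge points near \<open>z\<close> are seen from
  \<open>m\<close>, so they are not in \<open>T\<close>.\<close>

lemma separated_open_in_E:
  assumes ST: "S \<union> T = E" and no: "\<And>s t. s \<in> S \<Longrightarrow> t \<in> T \<Longrightarrow> \<not> vis s t" and "z \<in> S"
  obtains \<eta> where "\<eta> > 0" "\<And>w. w \<in> E \<Longrightarrow> dist w z < \<eta> \<Longrightarrow> w \<in> S"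
proof -
  have z: "z \<in> E" using assms by auto
  then have "z \<in> P" using frontier_eq frontier_subset by blast
  then obtain m where m: "m \<in> E" "vis z m" using sees_edge by blast
  then have "m \<in> S" using no[OF \<open>z \<in> S\<close>] ST by blast
  obtain \<eta> where \<eta>: "\<eta> > 0" "\<And>w. w \<in> E \<Longrightarrow> dist w z < \<eta> \<Longrightarrow> vis m w"
    using vis_edge[OF vis_sym[OF m(2)] z] by blast
  have "w \<in> S" if "w \<in> E" "dist w z < \<eta>" for w
    using no[OF \<open>m \<in> S\<close>, of w] \<eta>(2)[OF that] ST that by blast
  with that \<eta> show thesis by blast
qed

lemma seen_region_open:
  assumes "S \<subseteq> E"
  shows "open {x \<in> interior P. \<exists>z\<in>S. vis x z}"
  unfolding open_contains_ball
proof
  fix x assume "x \<in> {x \<in> interior P. \<exists>z\<in>S. vis x z}"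
  then obtain z where z: "x \<in> interior P" "z \<in> S" "vis x z" by auto
  obtain \<eta> where "\<eta> > 0" "\<And>w. dist w x < \<eta> \<Longrightarrow> vis w z" using vis_interior[OF z(3,1)] by blast
  moreover obtain e where "e > 0" "ball x e \<subseteq> interior P" using z(1) open_contains_ball by blast
  ultimately show "\<exists>e>0. ball x e \<subseteq> {x \<in> interior P. \<exists>z\<in>S. vis x z}"
    using z(2) by (intro exI[of _ "min \<eta> e"]) (auto simp: dist_commute intro!: bexI[of _ z])
qed

text \<open>A direction with a hit \<open>z\<close> in \<open>S\<close> is stable: nearby lines hit
  the same edge near \<open>z\<close>, in a point still in \<open>S\<close> and still seen from
  \<open>x\<close>. Since \<open>t\<close> may be negative, the set consists of directions of chords
  through \<open>x\<close>, not of rays.\<close>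

lemma seen_directions_open:
  assumes ST: "S \<union> T = E" and no: "\<And>s t. s \<in> S \<Longrightarrow> t \<in> T \<Longrightarrow> \<not> vis s t"
  shows "open {d. \<exists>t. x + t *\<^sub>R d \<in> S \<and> vis x (x + t *\<^sub>R d)}" (is "open ?D")
  unfolding open_contains_ball
proof
  fix d assume "d \<in> ?D"
  then obtain t where t: "x + t *\<^sub>R d \<in> S" "vis x (x + t *\<^sub>R d)" by auto
  define z where "z = x + t *\<^sub>R d"
  have z: "z \<in> S" "z \<in> E" "vis x z" using t ST by (auto simp: z_def)
  have "t \<noteq> 0" using t(2) by (auto simp: vis_def)
  obtain \<eta>1 where \<eta>1: "\<eta>1 > 0" "\<And>w. w \<in> E \<Longrightarrow> dist w z < \<eta>1 \<Longrightarrow> w \<in> S"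
    using separated_open_in_E[OF ST no z(1)] by metis
  obtain \<eta>2 where \<eta>2: "\<eta>2 > 0" "\<And>w. w \<in> E \<Longrightarrow> dist w z < \<eta>2 \<Longrightarrow> vis x w"
    using vis_edge[OF z(3,2)] by metis
  obtain n \<rho> where n: "edge_nbhd (frontier P) z n \<rho>" using edge z(2) by blast
  have "n \<bullet> (x - z) \<noteq> 0" using edge_transversal[OF n vis_sym[OF z(3)]] .
  then have "n \<bullet> (z - x) \<noteq> 0" by (simp add: inner_diff_right)
  then obtain \<epsilon> where \<epsilon>: "\<epsilon> > 0" "\<And>d. dist d (z - x) < \<epsilon> \<Longrightarrow>
      \<exists>t. \<bar>t - 1\<bar> < min \<eta>1 \<eta>2 \<and> x + t *\<^sub>R d \<in> E \<and> dist (x + t *\<^sub>R d) z < min \<eta>1 \<eta>2"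
    using ray_hits_edge[OF z(2) n, of x "min \<eta>1 \<eta>2"] \<eta>1(1) \<eta>2(1) by (metis min_less_iff_conj)
  \<comment> \<open>\<open>z - x\<close> is \<open>t\<close> times \<open>d\<close>, so the
    tolerance for \<open>d\<close> is divided by \<open>\<bar>t\<bar>\<close>.\<close>
  have "ball d (\<epsilon> / \<bar>t\<bar>) \<subseteq> ?D"
  proof
    fix d' assume "d' \<in> ball d (\<epsilon> / \<bar>t\<bar>)"
    then have "\<bar>t\<bar> * norm (d' - d) < \<epsilon>" using \<open>t \<noteq> 0\<close>
      by (simp add: dist_norm norm_minus_commute field_simps)
    moreover have "t *\<^sub>R d' - (z - x) = t *\<^sub>R (d' - d)" by (simp add: z_def algebra_simps)
    ultimately have "dist (t *\<^sub>R d') (z - x) < \<epsilon>" by (simp add: dist_norm)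
    from \<epsilon>(2)[OF this] obtain t' where t': "x + t' *\<^sub>R t *\<^sub>R d' \<in> E" "dist (x + t' *\<^sub>R t *\<^sub>R d') z < min \<eta>1 \<eta>2"
      by blast
    have "x + (t' * t) *\<^sub>R d' \<in> S" "vis x (x + (t' * t) *\<^sub>R d')"
      using \<eta>1(2)[OF t'(1)] \<eta>2(2)[OF t'(1)] t'(2) by auto
    then show "d' \<in> ?D" by blast
  qed
  then show "\<exists>e>0. ball d e \<subseteq> ?D" using \<epsilon>(1) \<open>t \<noteq> 0\<close> by (intro exI[of _ "\<epsilon> / \<bar>t\<bar>"]) auto
qed

text \<open>Seen boundary points on the same side of \<open>x\<close> agree, as the nearer one would
  block the farther; on opposite sides they see each other through the interior point
  \<open>x\<close>.\<close>

lemma chord_unique: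
  assumes x: "x \<in> interior P" and S: "x + t *\<^sub>R d \<in> frontier P" "vis x (x + t *\<^sub>R d)"
    and T: "x + t' *\<^sub>R d \<in> frontier P" "vis x (x + t' *\<^sub>R d)"
  shows "t = t' \<or> vis (x + t *\<^sub>R d) (x + t' *\<^sub>R d)"
proof -
  have ne: "t \<noteq> 0" "t' \<noteq> 0" "d \<noteq> 0" using S T by (auto simp: vis_def)
  have aux: False if "0 < t / t'" "t / t' < 1" "t' \<noteq> 0"
    "x + t *\<^sub>R d \<in> frontier P" "vis x (x + t' *\<^sub>R d)" for t t'
  proof -
    have "x + (t / t') *\<^sub>R (x + t' *\<^sub>R d - x) \<in> interior P" using that unfolding vis_iff by blast
    then have "x + t *\<^sub>R d \<in> interior P" using that by simp
    then show False using that interior_disjoint by blast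
  qed
  show ?thesis
  proof (cases "t * t' > 0")
    case True
    then have "t / t' > 0" "t' / t > 0" by (auto simp: zero_less_mult_iff zero_less_divide_iff)
    moreover have "t / t' < 1 \<or> t' / t < 1 \<or> t = t'"
      using True ne by (auto simp: zero_less_mult_iff divide_less_eq)
    ultimately show ?thesis using aux[of t t'] aux[of t' t] S T ne by blast
  next
    case False
    then have opp: "t * t' < 0" using ne by (simp add: not_less_iff_gr_or_eq less_le)
    define s where "s = t / (t - t')"
    have tt: "t - t' \<noteq> 0" using opp by auto
    have s: "0 < s" "s < 1" using opp tt unfolding s_def
      by (auto simp: mult_less_0_iff divide_less_eq zero_less_divide_iff)
    have "x + t *\<^sub>R d + s *\<^sub>R (x + t' *\<^sub>R d - (x + t *\<^sub>R d)) = x + (t - s * (t - t')) *\<^sub>R d"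
      by (simp add: algebra_simps)
    also have "\<dots> = x" using tt by (simp add: s_def)
    finally have "x + t *\<^sub>R d + s *\<^sub>R (x + t' *\<^sub>R d - (x + t *\<^sub>R d)) = x" .
    then show ?thesis using vis_join[of "x + t *\<^sub>R d" s "x + t' *\<^sub>R d"] s x vis_sym[OF S(2)] T(2) by metis
  qed
qed

text \<open>Suppose that no sight joins the classes. Both seen regions are open and nonempty and
  cover the connected interior, so they overlap in an open set; some \<open>x\<close> there lies on
  none of the finitely many lines through two vertices. The chord directions at \<open>x\<close>
  then split the punctured plane into two nonempty open sets, against its connectedness.\<close>

lemma edge_visibility_connected:
  assumes ST: "S \<union> T = E" and "S \<noteq> {}" "T \<noteq> {}"
  shows "S \<inter> T \<noteq> {} \<or> (\<exists>s\<in>S. \<exists>t\<in>T. vis s t)"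
proof (rule ccontr)
  assume "\<not> ?thesis"
  then have dis: "S \<inter> T = {}" and no: "\<And>s t. s \<in> S \<Longrightarrow> t \<in> T \<Longrightarrow> \<not> vis s t" by auto
  have TS: "T \<union> S = E" and no': "\<And>s t. s \<in> T \<Longrightarrow> t \<in> S \<Longrightarrow> \<not> vis s t" using ST no vis_sym by blast+
  define U where "U S = {x \<in> interior P. \<exists>z\<in>S. vis x z}" for S
  have "open (U S)" "open (U T)" unfolding U_def using ST by (auto intro!: seen_region_open)
  moreover have "U S \<noteq> {}" "U T \<noteq> {}"
    using sees_point_of_interior assms unfolding U_def by blast+
  moreover have "interior P \<subseteq> U S \<union> U T"
    using sees_edge ST interior_subset unfolding U_def by blast
  moreover have "U S \<subseteq> interior P" "U T \<subseteq> interior P" by (auto simp: U_def)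
  ultimately have "U S \<inter> U T \<noteq> {}"
    using connectedD[OF conn, of "U S" "U T"] by blast
  moreover have "open (U S \<inter> U T)" using \<open>open (U S)\<close> \<open>open (U T)\<close> by (rule open_Int)
  \<comment> \<open>Measure provides the generic \<open>x\<close>: a nonempty open set is not null,
    a finite union of lines is.\<close>
  ultimately have "\<not> negligible (U S \<inter> U T)" by (simp add: open_not_negligible)
  \<comment> \<open>The line through \<open>v\<close> and \<open>v'\<close>, given by its normal
    \<open>\<i> * (v' - v)\<close>.\<close>
  moreover define L where "L v v' = {x. (\<i> * (v' - v)) \<bullet> x = (\<i> * (v' - v)) \<bullet> v}" for v v' :: complex
  have "negligible (\<Union>v\<in>V. \<Union>v'\<in>V - {v}. L v v')"
    unfolding L_def using finV
    by (intro negligible_Union finite_imageI) (auto intro!: negligible_Union finite_imageI negligible_hyperplane)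
  ultimately have "\<not> U S \<inter> U T \<subseteq> (\<Union>v\<in>V. \<Union>v'\<in>V - {v}. L v v')"
    using negligible_subset by blast
  then obtain x where x: "x \<in> U S" "x \<in> U T" "\<And>v v'. v \<in> V \<Longrightarrow> v' \<in> V \<Longrightarrow> v \<noteq> v' \<Longrightarrow> x \<notin> L v v'"
    by blast
  have xi: "x \<in> interior P" using x(1) by (simp add: U_def)
  define D where "D S = {d. \<exists>t. x + t *\<^sub>R d \<in> S \<and> vis x (x + t *\<^sub>R d)}" for S
  have op: "open (D S)" "open (D T)" unfolding D_def
    using seen_directions_open[OF ST no] seen_directions_open[OF TS no'] by auto
  have nz: "d \<noteq> 0" if "d \<in> D S \<union> D T" for d using that by (auto simp: D_def vis_def)
  have nonempty: "D A \<noteq> {}" if "x \<in> U A" for A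
  proof -
    from that obtain z where "z \<in> A" "vis x z" by (auto simp: U_def)
    then have "z - x \<in> D A" unfolding D_def by (auto intro!: exI[of _ 1])
    then show ?thesis by blast
  qed
  have "D S \<inter> D T = {}"
  proof (rule ccontr)
    assume "\<not> ?thesis"
    then obtain d t t' where d: "x + t *\<^sub>R d \<in> S" "vis x (x + t *\<^sub>R d)"
      "x + t' *\<^sub>R d \<in> T" "vis x (x + t' *\<^sub>R d)" by (auto simp: D_def)
    then have "x + t *\<^sub>R d \<in> frontier P" "x + t' *\<^sub>R d \<in> frontier P" using ST frontier_eq by auto
    then have "t = t' \<or> vis (x + t *\<^sub>R d) (x + t' *\<^sub>R d)" using chord_unique[OF xi] d by blast
    then show False using d dis no by blast
  qed
  moreover have "- {0} \<subseteq> D S \<union> D T"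
  proof
    fix d :: complex assume d: "d \<in> - {0}"
    obtain e where e: "e > 0" "\<And>t. \<bar>t\<bar> < e \<Longrightarrow> x + t *\<^sub>R d \<in> interior P"
    proof -
      obtain r where r: "r > 0" "ball x r \<subseteq> interior P" using xi open_contains_ball by blast
      then show thesis using small_step[of x x r d] that by (metis centre_in_ball subsetD)
    qed
    have "x + t *\<^sub>R (- d) \<in> interior P" if "0 < t" "t < e" for t using e(2)[of "- t"] that by simp
    then obtain t2 where t2: "t2 > 0" "x + t2 *\<^sub>R (- d) \<in> frontier P" "vis x (x + t2 *\<^sub>R (- d))"
      using first_hit[of "- d" e x] d e(1) by (metis ComplD neg_equal_0_iff_equal singletonI)
    obtain t1 where t1: "t1 > 0" "x + t1 *\<^sub>R d \<in> frontier P" "vis x (x + t1 *\<^sub>R d)"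
      using first_hit[of d e x] d e by (metis ComplD abs_of_pos singletonI)
    have "x + t1 *\<^sub>R d \<in> E \<or> x + t2 *\<^sub>R (- d) \<in> E"
    proof (rule ccontr)
      assume "\<not> ?thesis"
      then have V: "x + t1 *\<^sub>R d \<in> V" "x + t2 *\<^sub>R (- d) \<in> V" using t1 t2 frontier_eq by auto
      have diff: "x + t2 *\<^sub>R (- d) - (x + t1 *\<^sub>R d) = - (t1 + t2) *\<^sub>R d" by (simp add: algebra_simps)
      then have "x + t1 *\<^sub>R d \<noteq> x + t2 *\<^sub>R (- d)" using d t1 t2
        by (metis ComplD add_pos_pos eq_iff_diff_eq_0 less_irrefl neg_equal_0_iff_equal scaleR_eq_0_iff singletonI)
      then have "x \<notin> L (x + t1 *\<^sub>R d) (x + t2 *\<^sub>R (- d))" using x(3) V by blast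
      moreover have "(\<i> * (c *\<^sub>R d)) \<bullet> (t1 *\<^sub>R d) = 0" for c by (simp add: inner_complex_def)
      ultimately show False unfolding L_def diff by (simp only: inner_right_distrib mem_Collect_eq)
    qed
    \<comment> \<open>A hit in the opposite direction counts for \<open>d\<close> with the parameter
      \<open>- t2\<close>.\<close>
    then have "d \<in> D E" using t1 t2 unfolding D_def
      by (auto intro: exI[of _ t1] exI[of _ "- t2"])
    then show "d \<in> D S \<union> D T" unfolding D_def using ST by blast
  qed
  moreover have "connected (- {0::complex})"
    by (intro connected_punctured_universe) simp
  ultimately show False
    using connectedD[of "- {0}" "D S" "D T"] op nonempty[OF x(1)] nonempty[OF x(2)] nz by blast
qed

subsection \<open>Passing a vertex\<close>

lemma end_nbhdI:
  assumes "open W" "convex W" "W \<subseteq> interior P" "b \<in> closure W"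
    and "e > 0" "\<And>t. 0 < t \<Longrightarrow> t < e \<Longrightarrow> b + t *\<^sub>R (y - b) \<in> W"
  shows "end_nbhd b y W"
proof -
  have "b + min (e/2) (1/2) *\<^sub>R (y - b) \<in> W" using assms(5) by (intro assms(6)) auto
  then show ?thesis unfolding end_nbhd_def using assms by (auto intro!: exI[of _ "min (e/2) (1/2)"])
qed

text \<open>The line \<open>A \<bullet> (w - b) = 0\<close> carries the edge along \<open>v\<close>
  and its prolongation beyond \<open>b\<close>. Near \<open>b\<close> both therefore lie in the
  closure of the half disc in front of this edge, and that half disc is an end neighbourhood for
  every line from \<open>b\<close> entering it.\<close>

lemma corner_side:
  assumes c: "corner (frontier P) b A B u v \<rho>"
    and sub: "{w \<in> ball b \<rho>. A \<bullet> (w - b) < 0} \<subseteq> interior P"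
  shows "\<And>w. w \<in> ball b \<rho> \<Longrightarrow> A \<bullet> (w - b) \<le> 0 \<Longrightarrow> w \<in> closure {w \<in> ball b \<rho>. A \<bullet> (w - b) < 0}"
    and "\<And>y. A \<bullet> (y - b) < 0 \<Longrightarrow> end_nbhd b y {w \<in> ball b \<rho>. A \<bullet> (w - b) < 0}"
proof -
  have \<rho>: "\<rho> > 0" "A \<bullet> u = 1" using c by (auto simp: corner_def)
  let ?W = "{w \<in> ball b \<rho>. A \<bullet> (w - b) < 0}"
  show cl: "w \<in> closure ?W" if w: "w \<in> ball b \<rho>" "A \<bullet> (w - b) \<le> 0" for w
  proof -
    obtain e where e: "e > 0" "\<And>t. \<bar>t\<bar> < e \<Longrightarrow> w + t *\<^sub>R (- u) \<in> ball b \<rho>"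
      using small_step[OF w(1)] by blast
    show ?thesis
    proof (rule closure_rayI[OF e(1)])
      fix t :: real assume "0 < t" "t < e"
      then show "w + t *\<^sub>R (- u) \<in> ?W" using e(2)[of t] w(2) \<rho>(2)
        by (simp add: inner_right_distrib inner_diff_right)
    qed
  qed
  have W: "?W = {w. A \<bullet> w < A \<bullet> b} \<inter> ball b \<rho>" by (auto simp: inner_diff_right)
  have bb: "b \<in> ball b \<rho>" using \<rho> by simp
  fix y assume y: "A \<bullet> (y - b) < 0"
  obtain e where e: "e > 0" "\<And>t. \<bar>t\<bar> < e \<Longrightarrow> b + t *\<^sub>R (y - b) \<in> ball b \<rho>"
    using small_step[OF bb] by blast
  show "end_nbhd b y ?W"
  proof (rule end_nbhdI[OF _ _ sub _ e(1)])
    show "open ?W" "convex ?W" unfolding W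
      by (auto intro!: open_Int convex_Int convex_halfspace_lt open_halfspace_lt)
    show "b \<in> closure ?W" by (rule cl[OF bb]) simp
    fix t :: real assume "0 < t" "t < e"
    then show "b + t *\<^sub>R (y - b) \<in> ?W" using e(2)[of t] y by (simp add: mult_pos_neg)
  qed
qed

lemma corner_edge_points:
  assumes c: "corner (frontier P) b A B u v \<rho>"
  obtains e where "e > 0" "\<And>t. 0 < t \<Longrightarrow> t < e \<Longrightarrow> b + t *\<^sub>R v \<in> E \<and> b + t *\<^sub>R v \<in> ball b \<rho>"
proof -
  have \<rho>: "\<rho> > 0" "A \<bullet> v = 0" "B \<bullet> v = 1" using c by (auto simp: corner_def)
  have "closed (V - {b})" using finV by (simp add: finite_imp_closed)
  then have "open (- (V - {b}))" by (rule open_Compl)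
  then obtain r where r: "r > 0" "ball b r \<subseteq> - (V - {b})" by (meson ComplI DiffD2 insertI1 open_contains_ball)
  have "b \<in> ball b (min r \<rho>)" using r \<rho> by simp
  then obtain e where e: "e > 0" "\<And>t. \<bar>t\<bar> < e \<Longrightarrow> b + t *\<^sub>R v \<in> ball b (min r \<rho>)"
    using small_step by metis
  have "b + t *\<^sub>R v \<in> E \<and> b + t *\<^sub>R v \<in> ball b \<rho>" if t: "0 < t" "t < e" for t
  proof -
    have b: "b + t *\<^sub>R v \<in> ball b \<rho>" "b + t *\<^sub>R v \<in> ball b r" using e(2)[of t] t by auto
    have "b + t *\<^sub>R v \<in> frontier P" using c b t \<rho> unfolding corner_def by auto
    moreover have "v \<noteq> 0" using \<rho> by auto
    then have "b + t *\<^sub>R v \<noteq> b" using t by simp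
    then have "b + t *\<^sub>R v \<notin> V" using r b by blast
    ultimately show ?thesis using b frontier_eq by blast
  qed
  with that e show thesis by blast
qed

text \<open>At a reflex vertex \<open>b\<close>, neither edge may have both \<open>p\<close> and \<open>y\<close> in front of it. Then \<open>z\<close> is
  where the line from \<open>p'\<close> grazing \<open>b\<close> hits the boundary beyond \<open>b\<close>. Moving \<open>p\<close> to a generic
  \<open>p'\<close> keeps this hit away from the vertices.\<close>
lemma corner_pivot_opposite:
  assumes c: "corner (frontier P) b A B u v \<rho>"
    and WA: "{w \<in> ball b \<rho>. A \<bullet> (w - b) < 0} \<subseteq> interior P"
    and WB: "{w \<in> ball b \<rho>. B \<bullet> (w - b) < 0} \<subseteq> interior P"
    and p: "p \<in> E" "vis b p" "A \<bullet> (p - b) \<ge> 0" "B \<bullet> (p - b) < 0"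
    and y: "vis b y" "A \<bullet> (y - b) < 0" and \<eta>: "\<eta> > 0"
  shows "\<exists>p'\<in>E. dist p' p < \<eta> \<and> (\<exists>q\<in>E. vis q y \<and> (vis p' q \<or> (\<exists>z\<in>E. vis p' z \<and> vis z q)))"
proof -
  let ?WA = "{w \<in> ball b \<rho>. A \<bullet> (w - b) < 0}"
  let ?WB = "{w \<in> ball b \<rho>. B \<bullet> (w - b) < 0}"
  have \<rho>: "\<rho> > 0" and uv: "A \<bullet> u = 1" "A \<bullet> v = 0" "B \<bullet> u = 0" "B \<bullet> v = 1"
    using c by (auto simp: corner_def)
  note clA = corner_side(1)[OF c WA] and endA = corner_side(2)[OF c WA]
  note clB = corner_side(1)[OF corner_swap[OF c] WB] and endB = corner_side(2)[OF corner_swap[OF c] WB]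
  obtain e1 where e1: "e1 > 0" "\<And>t. 0 < t \<Longrightarrow> t < e1 \<Longrightarrow> b + t *\<^sub>R v \<in> E \<and> b + t *\<^sub>R v \<in> ball b \<rho>"
    using corner_edge_points[OF c] by blast
  obtain n \<sigma> where n: "edge_nbhd (frontier P) p n \<sigma>" using edge p(1) by blast
  have nb: "n \<bullet> (b - p) \<noteq> 0" using edge_transversal[OF n vis_sym[OF p(2)]] .
  \<comment> \<open>\<open>d\<close> runs along the edge through \<open>p\<close>, so small shifts
    by it keep \<open>p\<close> on the edge and in sight of \<open>b\<close>.\<close>
  define d where "d = \<i> * n"
  obtain e2 where e2: "e2 > 0" "\<And>w. w \<in> E \<Longrightarrow> dist w p < e2 \<Longrightarrow> vis b w" using vis_edge[OF p(2,1)] by blast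
  obtain e3 where e3: "e3 > 0" "\<And>w. w \<in> ball p e3 \<Longrightarrow> w \<in> frontier P \<Longrightarrow> w \<in> E" using E_near[OF p(1)] by blast
  have "p \<in> ball p (min (min e2 e3) (min \<eta> \<sigma>))" using e2 e3 n \<eta> by (auto simp: edge_nbhd_def)
  then obtain e4 where e4: "e4 > 0" "\<And>s. \<bar>s\<bar> < e4 \<Longrightarrow> p + s *\<^sub>R d \<in> ball p (min (min e2 e3) (min \<eta> \<sigma>))"
    using small_step by metis
  have shift: "p + s *\<^sub>R d \<in> E \<and> vis b (p + s *\<^sub>R d) \<and> dist (p + s *\<^sub>R d) p < \<eta>" if "\<bar>s\<bar> < e4" for s
  proof -
    have b: "dist (p + s *\<^sub>R d) p < min (min e2 e3) (min \<eta> \<sigma>)" using e4(2)[OF that] by (simp add: dist_commute)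
    have "n \<bullet> (p + s *\<^sub>R d - p) = 0" by (simp add: d_def inner_complex_def)
    then have "p + s *\<^sub>R d \<in> frontier P" using n b unfolding edge_nbhd_def by (auto simp: dist_commute)
    then have "p + s *\<^sub>R d \<in> E" using e3(2) b by (simp add: dist_commute)
    then show ?thesis using e2(2) b by auto
  qed
  show ?thesis
  proof (cases "A \<bullet> (p - b) = 0")
    case True
    \<comment> \<open>Here \<open>p\<close> lies on the line of the edge along \<open>v\<close>. A
      shift leaves this line, since otherwise the edge through \<open>p\<close> would point towards
      \<open>b\<close>, contradicting \<open>nb\<close>.\<close>
    have Ad: "A \<bullet> d \<noteq> 0"
    proof
      assume "A \<bullet> d = 0"
      then have 0: "Im A * Re n = Re A * Im n" by (simp add: d_def inner_complex_def algebra_simps)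
      have 1: "Re A * Re (p - b) = - (Im A * Im (p - b))" using True by (simp add: inner_complex_def algebra_simps)
      have "Re A * (n \<bullet> (p - b)) = Re n * (Re A * Re (p - b)) + (Re A * Im n) * Im (p - b)"
        by (simp add: inner_complex_def algebra_simps)
      also have "\<dots> = 0" unfolding 1 0[symmetric] by (simp add: algebra_simps)
      finally have a: "Re A * (n \<bullet> (p - b)) = 0" .
      have "Im A * (n \<bullet> (p - b)) = (Im A * Re n) * Re (p - b) + Im n * (Im A * Im (p - b))"
        by (simp add: inner_complex_def algebra_simps)
      also have "\<dots> = Im n * (Re A * Re (p - b) + Im A * Im (p - b))" unfolding 0 by (simp add: algebra_simps)
      also have "\<dots> = 0" unfolding 1 by simp
      finally have "Im A * (n \<bullet> (p - b)) = 0" .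
      moreover have "n \<bullet> (p - b) \<noteq> 0" using nb by (simp add: inner_diff_right)
      ultimately have "A = 0" using a by (simp add: complex_eq_iff)
      with uv show False by simp
    qed
    \<comment> \<open>The sign moves \<open>p'\<close> to the side of \<open>y\<close>, in front of
      the edge along \<open>v\<close>; a single \<open>q\<close> on that edge near \<open>b\<close>
      then suffices.\<close>
    define s where "s = - sgn (A \<bullet> d) * (e4 / 2)"
    have s: "\<bar>s\<bar> < e4" using e4(1) Ad by (simp add: s_def abs_mult abs_sgn_eq)
    define p' where "p' = p + s *\<^sub>R d"
    have p': "p' \<in> E" "vis b p'" "dist p' p < \<eta>" using shift[OF s] by (auto simp: p'_def)
    have "A \<bullet> (p' - b) = A \<bullet> (p - b) + s * (A \<bullet> d)" by (simp add: p'_def inner_diff_right inner_right_distrib)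
    also have "\<dots> = - (e4 / 2) * \<bar>A \<bullet> d\<bar>" using True by (simp add: s_def abs_sgn mult_ac)
    also have "\<dots> < 0" using e4(1) Ad by (simp add: mult_neg_pos)
    finally have "A \<bullet> (p' - b) < 0" .
    obtain e5 where e5: "e5 > 0" "\<And>q. q \<in> closure ?WA \<Longrightarrow> dist q b < e5 \<Longrightarrow> vis q p'"
      using vis_near[OF p'(2) endA[OF \<open>A \<bullet> (p' - b) < 0\<close>]] by blast
    obtain e6 where e6: "e6 > 0" "\<And>q. q \<in> closure ?WA \<Longrightarrow> dist q b < e6 \<Longrightarrow> vis q y"
      using vis_near[OF y(1) endA[OF y(2)]] by blast
    have "b \<in> ball b (min e5 e6)" using e5 e6 by simp
    then obtain e7 where e7: "e7 > 0" "\<And>t. \<bar>t\<bar> < e7 \<Longrightarrow> b + t *\<^sub>R v \<in> ball b (min e5 e6)"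
      using small_step by metis
    define q where "q = b + (min e1 e7 / 2) *\<^sub>R v"
    have "q \<in> E" "q \<in> ball b \<rho>" using e1 e7(1) unfolding q_def
      by (auto simp: min_def split: if_splits)
    moreover have "dist q b < min e5 e6" using e7(2)[of "min e1 e7 / 2"] e1(1) e7(1)
      by (auto simp: q_def dist_commute)
    moreover have "q \<in> closure ?WA" using \<open>q \<in> ball b \<rho>\<close> uv by (intro clA) (auto simp: q_def)
    ultimately have "vis q p'" "vis q y" using e5(2)[of q] e6(2)[of q] by auto
    then show ?thesis using p' \<open>q \<in> E\<close> vis_sym by blast
  next
    case False
    then have Ap: "A \<bullet> (p - b) > 0" using p by simp
    have lim: "((\<lambda>s. C \<bullet> (p + s *\<^sub>R d - b)) \<longlongrightarrow> C \<bullet> (p + 0 *\<^sub>R d - b)) (nhds 0)" for C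
      by (intro tendsto_intros filterlim_ident)
    have "eventually (\<lambda>s. A \<bullet> (p + s *\<^sub>R d - b) > 0 \<and> B \<bullet> (p + s *\<^sub>R d - b) < 0) (nhds 0)"
      using order_tendstoD(1)[OF lim[of A], of 0] order_tendstoD(2)[OF lim[of B], of 0] Ap p(4)
      by (auto intro: eventually_conj)
    then obtain e5 where e5: "e5 > 0" "\<And>s. \<bar>s\<bar> < e5 \<Longrightarrow> A \<bullet> (p + s *\<^sub>R d - b) > 0 \<and> B \<bullet> (p + s *\<^sub>R d - b) < 0"
      unfolding eventually_nhds_metric by (auto simp: dist_real_def)
    have "cr (p - b) d = n \<bullet> (p - b)" by (simp add: cr_def d_def inner_complex_def)
    then have "cr (p - b) d \<noteq> 0" using nb by (simp add: inner_diff_right)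
    moreover have "finite ((\<lambda>v. v - b) ` V)" using finV by simp
    ultimately obtain s where s: "0 < s" "s < min e4 e5"
      "\<And>v. v \<in> (\<lambda>v. v - b) ` V \<Longrightarrow> v \<noteq> 0 \<Longrightarrow> cr (p - b + s *\<^sub>R d) v \<noteq> 0"
      using generic_direction[of "(\<lambda>v. v - b) ` V" "min e4 e5" "p - b" d] e4(1) e5(1) by (metis min_less_iff_conj)
    define p' where "p' = p + s *\<^sub>R d"
    have p': "p' \<in> E" "vis b p'" "dist p' p < \<eta>" using shift[of s] s by (auto simp: p'_def)
    have sgp: "A \<bullet> (p' - b) > 0" "B \<bullet> (p' - b) < 0" using e5(2)[of s] s by (auto simp: p'_def)
    have generic: "\<And>v. v \<in> V \<Longrightarrow> v \<noteq> b \<Longrightarrow> cr (p' - b) (v - b) \<noteq> 0"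
      using s(3) by (force simp: p'_def algebra_simps)
    have bb: "b \<in> ball b \<rho>" using \<rho> by simp
    \<comment> \<open>The line from \<open>p'\<close> continues straight past \<open>b\<close> and
      enters the half disc in front of the edge along \<open>v\<close>.\<close>
    define h0 where "h0 = - (p' - b)"
    have "h0 \<noteq> 0" using sgp by (auto simp: h0_def)
    obtain e6 where e6: "e6 > 0" "\<And>t. \<bar>t\<bar> < e6 \<Longrightarrow> b + t *\<^sub>R h0 \<in> ball b \<rho>"
      using small_step[OF bb] by blast
    have "b + t *\<^sub>R h0 \<in> interior P" if t: "0 < t" "t < e6" for t
    proof -
      have "A \<bullet> (t *\<^sub>R h0) < 0" using t sgp by (simp add: h0_def inner_diff_right algebra_simps)
      then show ?thesis using WA e6(2)[of t] t by auto
    qed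
    then obtain th where th: "th > 0" "b + th *\<^sub>R h0 \<in> frontier P" "vis b (b + th *\<^sub>R h0)"
      using first_hit[OF \<open>h0 \<noteq> 0\<close> e6(1)] by metis
    define h where "h = b + th *\<^sub>R h0"
    have "h \<noteq> b" using th \<open>h0 \<noteq> 0\<close> by (simp add: h_def)
    have "h - b = (- th) *\<^sub>R (p' - b)" by (simp add: h_def h0_def algebra_simps)
    then have "cr (p' - b) (h - b) = 0" by (simp only: cr_scaleR_right cr_self)
    then have "h \<in> E" using generic[of h] \<open>h \<noteq> b\<close> th(2) frontier_eq unfolding h_def by blast
    have vbh: "vis b h" using th by (simp add: h_def)
    define k where "k = 1 + th"
    have k: "k > 1" using th by (simp add: k_def)
    have hp: "h - p' = k *\<^sub>R (b - p')" by (simp add: h_def h0_def k_def algebra_simps)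
    have hb: "h - b = th *\<^sub>R (b - p')" by (simp add: h_def h0_def algebra_simps)
    obtain n2 \<sigma>2 where n2: "edge_nbhd (frontier P) h n2 \<sigma>2" using edge \<open>h \<in> E\<close> by blast
    have "n2 \<bullet> (b - h) \<noteq> 0" using edge_transversal[OF n2 vis_sym[OF vbh]] .
    then have "n2 \<bullet> (h - b) \<noteq> 0" by (simp add: inner_diff_right)
    then have "n2 \<bullet> (b - p') \<noteq> 0" unfolding hb by simp
    then have nhp: "n2 \<bullet> (h - p') \<noteq> 0" unfolding hp using k by simp
    have "A \<bullet> (h - b) = - (th * (A \<bullet> (p' - b)))" unfolding hb by (simp add: inner_diff_right algebra_simps)
    then have Ah: "A \<bullet> (h - b) < 0" using th sgp by simp
    obtain e7 where e7: "e7 > 0"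
      "\<And>q z. \<lbrakk>q \<in> closure ?WA; z \<in> E; dist q b < e7; dist z h < e7\<rbrakk> \<Longrightarrow> vis q z"
      using vis_near_edge[OF vbh endA[OF Ah] \<open>h \<in> E\<close>] by blast
    obtain e8 where e8: "e8 > 0" "\<And>q. q \<in> closure ?WB \<Longrightarrow> dist q b < e8 \<Longrightarrow> vis q p'"
      using vis_near[OF p'(2) endB[OF sgp(2)]] by blast
    obtain e9 where e9: "e9 > 0" "\<And>q. q \<in> closure ?WA \<Longrightarrow> dist q b < e9 \<Longrightarrow> vis q y"
      using vis_near[OF y(1) endA[OF y(2)]] by blast
    \<comment> \<open>The term \<open>1 - 1 / k\<close> forces \<open>t * k > 1\<close>, so that
      \<open>z\<close> lies beyond \<open>m\<close> as seen from \<open>p'\<close>.\<close>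
    define \<theta> where "\<theta> = min e7 (1 - 1 / k)"
    have \<theta>: "\<theta> > 0" using e7 k by (simp add: \<theta>_def)
    obtain e10 where e10: "e10 > 0" "\<And>d. dist d (h - p') < e10 \<Longrightarrow>
        \<exists>t. \<bar>t - 1\<bar> < \<theta> \<and> p' + t *\<^sub>R d \<in> E \<and> dist (p' + t *\<^sub>R d) h < \<theta>"
      using ray_hits_edge[OF \<open>h \<in> E\<close> n2 nhp \<theta>] by blast
    \<comment> \<open>\<open>h - p'\<close> is \<open>k\<close> times \<open>b - p'\<close>, whence
      the radius \<open>e10 / k\<close> for moving \<open>b\<close> to \<open>m\<close>.\<close>
    have "b \<in> ball b (min (min \<rho> (e10 / k)) (min e7 (min e8 e9)))"
      using \<rho> e7 e8 e9 e10 k by simp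
    then obtain e11 where e11: "e11 > 0"
      "\<And>t. \<bar>t\<bar> < e11 \<Longrightarrow> b + t *\<^sub>R v \<in> ball b (min (min \<rho> (e10 / k)) (min e7 (min e8 e9)))"
      using small_step by metis
    define \<epsilon> where "\<epsilon> = min e1 e11 / 2"
    have \<epsilon>: "0 < \<epsilon>" "\<epsilon> < e1" "\<epsilon> < e11" using e1(1) e11(1) by (auto simp: \<epsilon>_def)
    \<comment> \<open>The grazing point: just past \<open>b\<close> on the prolongation of the edge
      along \<open>v\<close>, inside \<open>P\<close>. It is in the closure of both half discs, so
      \<open>p'\<close> sees it across \<open>?WB\<close> and it sees \<open>z\<close> across
      \<open>?WA\<close>; hence \<open>p'\<close> sees \<open>z\<close> through
      \<open>m\<close>.\<close>
    define m where "m = b + (- \<epsilon>) *\<^sub>R v"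
    have mb: "m \<in> ball b \<rho>" "dist m b < e10 / k" "dist m b < e7" "dist m b < e8"
      using e11(2)[of "- \<epsilon>"] \<epsilon> by (auto simp: m_def dist_commute)
    have mAB: "A \<bullet> (m - b) = 0" "B \<bullet> (m - b) < 0" using uv \<epsilon> by (auto simp: m_def)
    have mi: "m \<in> interior P" using WB mb mAB by blast
    have "m \<in> closure ?WB" "m \<in> closure ?WA" using clA[of m] clB[of m] mb mAB by auto
    then have vpm: "vis p' m" using e8(2)[of m] mb vis_sym by blast
    have "k *\<^sub>R (m - p') - (h - p') = k *\<^sub>R (m - b)" unfolding hp by (simp add: algebra_simps)
    then have "dist (k *\<^sub>R (m - p')) (h - p') = k * dist m b" using k by (simp add: dist_norm)
    also have "\<dots> < e10" using mb(2) k by (simp add: field_simps)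
    finally obtain t where t: "\<bar>t - 1\<bar> < \<theta>" "p' + t *\<^sub>R k *\<^sub>R (m - p') \<in> E"
      "dist (p' + t *\<^sub>R k *\<^sub>R (m - p')) h < \<theta>" using e10(2) by blast
    define z where "z = p' + (t * k) *\<^sub>R (m - p')"
    have z: "z \<in> E" "dist z h < e7" using t by (auto simp: z_def \<theta>_def)
    have "1 / k < t" using t(1) by (simp add: \<theta>_def abs_if split: if_splits)
    then have tk: "t * k > 1" using k by (simp add: field_simps)
    have m_eq: "m = p' + (1 / (t * k)) *\<^sub>R (z - p')"
    proof -
      have "t * k \<noteq> 0" using tk by linarith
      then show ?thesis by (simp add: z_def)
    qed
    have "vis m z" using e7(2)[of m z] \<open>m \<in> closure ?WA\<close> z mb by blast
    then have vpz: "vis p' z" using vis_join[of p' "1 / (t * k)" z] vpm mi tk unfolding m_eq[symmetric] by simp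
    \<comment> \<open>The reflection of \<open>m\<close> in \<open>b\<close> lies on the edge itself
      and sees both \<open>z\<close> and \<open>y\<close> across \<open>?WA\<close>.\<close>
    define q where "q = b + \<epsilon> *\<^sub>R v"
    have q: "q \<in> E" "q \<in> ball b \<rho>" using e1(2) \<epsilon> by (auto simp: q_def)
    have qd: "dist q b < e7" "dist q b < e9" using e11(2)[of \<epsilon>] \<epsilon> by (auto simp: q_def dist_commute)
    have "q \<in> closure ?WA" using q uv by (intro clA) (auto simp: q_def)
    then have "vis q z" "vis q y" using e7(2)[of q z] e9(2)[of q] qd z by auto
    then show ?thesis using p' q(1) z(1) vpz vis_sym by blast
  qed
qed

text \<open>At a convex vertex the interior is locally the wedge \<open>C\<close>, and a point
  \<open>q\<close> of either edge close to \<open>b\<close> sees both \<open>p\<close> and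
  \<open>y\<close>. At a reflex vertex it is locally the union of the half discs \<open>WA\<close>
  and \<open>WB\<close>: if one of them contains the beginnings of both sight lines, its edge
  supplies \<open>q\<close>; otherwise \<open>corner_pivot_opposite\<close> applies, up to
  exchanging the edges.\<close>

lemma corner_pivot:
  assumes b: "b \<in> V" and p: "p \<in> E" "vis b p" and y: "vis b y" and \<eta>: "\<eta> > 0"
  shows "\<exists>p'\<in>E. dist p' p < \<eta> \<and> (\<exists>q\<in>E. vis q y \<and> (vis p' q \<or> (\<exists>z\<in>E. vis p' z \<and> vis z q)))"
proof -
  from vertex[OF b] obtain A B u v \<rho> where c: "corner (frontier P) b A B u v \<rho>" by blast
  have \<rho>: "\<rho> > 0" and uv: "A \<bullet> u = 1" "A \<bullet> v = 0" "B \<bullet> u = 0" "B \<bullet> v = 1"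
    and rep: "\<And>x. x = (A \<bullet> x) *\<^sub>R u + (B \<bullet> x) *\<^sub>R v"
    and fr: "\<And>w. w \<in> ball b \<rho> \<Longrightarrow> w \<in> frontier P \<longleftrightarrow>
       (A \<bullet> (w - b) \<ge> 0 \<and> B \<bullet> (w - b) = 0) \<or> (A \<bullet> (w - b) = 0 \<and> B \<bullet> (w - b) \<ge> 0)"
    using c unfolding corner_def by blast+
  have bb: "b \<in> ball b \<rho>" using \<rho> by simp
  define WA where "WA = {w \<in> ball b \<rho>. A \<bullet> (w - b) < 0}"
  define WB where "WB = {w \<in> ball b \<rho>. B \<bullet> (w - b) < 0}"
  define C where "C = {w \<in> ball b \<rho>. A \<bullet> (w - b) > 0 \<and> B \<bullet> (w - b) > 0}"
  have WA': "WA = {w. A \<bullet> w < A \<bullet> b} \<inter> ball b \<rho>" by (auto simp: WA_def inner_diff_right)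
  have WB': "WB = {w. B \<bullet> w < B \<bullet> b} \<inter> ball b \<rho>" by (auto simp: WB_def inner_diff_right)
  have C': "C = {w. A \<bullet> w > A \<bullet> b} \<inter> {w. B \<bullet> w > B \<bullet> b} \<inter> ball b \<rho>" by (auto simp: C_def inner_diff_right)
  have conv: "convex WA" "convex WB" "convex C" unfolding WA' WB' C'
    by (auto intro!: convex_Int convex_halfspace_lt convex_halfspace_gt)
  have opC: "open C" unfolding C' by (auto intro!: open_Int open_halfspace_gt)
  have dis: "WA \<inter> frontier P = {}" "WB \<inter> frontier P = {}" "C \<inter> frontier P = {}"
    using fr by (auto simp: WA_def WB_def C_def)
  obtain e where e: "e > 0" "\<And>t. \<bar>t\<bar> < e \<Longrightarrow> b + t *\<^sub>R (- u - v) \<in> ball b \<rho>"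
    using small_step[OF bb] by blast
  have "b + (e/2) *\<^sub>R (- u - v) \<in> WA \<inter> WB"
    using e(1) e(2)[of "e/2"] uv
    by (simp add: WA_def WB_def inner_diff_right inner_add_right algebra_simps)
  then have WAB: "WA \<inter> WB \<noteq> {}" by blast
  have in_both: "WA \<subseteq> interior P \<and> WB \<subseteq> interior P" if "(WA \<union> WB) \<inter> interior P \<noteq> {}"
  proof -
    have "connected (WA \<union> WB)" using conv WAB by (intro connected_Un convex_connected)
    then have "WA \<union> WB \<subseteq> interior P" using connected_subset_interior that dis by blast
    then show ?thesis by blast
  qed
  have inC: "C \<subseteq> interior P" if "C \<inter> interior P \<noteq> {}"
    using connected_subset_interior that dis conv convex_connected by blast
  \<comment> \<open>Otherwise a full disc around \<open>b\<close> would lie in \<open>P\<close>,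
    making \<open>b\<close> an interior point.\<close>
  have not_both: "\<not> (C \<subseteq> interior P \<and> WA \<subseteq> interior P \<and> WB \<subseteq> interior P)"
  proof
    assume *: "C \<subseteq> interior P \<and> WA \<subseteq> interior P \<and> WB \<subseteq> interior P"
    have "ball b \<rho> \<subseteq> P"
    proof
      fix w assume w: "w \<in> ball b \<rho>"
      then consider "w \<in> C" | "w \<in> WA" | "w \<in> WB" | "w \<in> frontier P"
        unfolding C_def WA_def WB_def using fr[OF w] by fastforce
      then show "w \<in> P" using * frontier_subset interior_subset by cases blast+
    qed
    then have "b \<in> interior P" using bb by (meson interior_maximal open_ball subsetD)
    then show False using b frontier_eq interior_disjoint by blast
  qed
  have start: "(A \<bullet> (x - b) > 0 \<and> B \<bullet> (x - b) > 0 \<and> C \<inter> interior P \<noteq> {}) \<or>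
      ((A \<bullet> (x - b) < 0 \<or> B \<bullet> (x - b) < 0) \<and> (WA \<union> WB) \<inter> interior P \<noteq> {})" if vx: "vis b x" for x
  proof -
    obtain e where e: "e > 0" "\<And>t. \<bar>t\<bar> < e \<Longrightarrow> b + t *\<^sub>R (x - b) \<in> ball b \<rho>"
      using small_step[OF bb] by blast
    define t where "t = min (e/2) (1/2)"
    have t: "0 < t" "t < 1" "t < e" using e by (auto simp: t_def)
    have w: "b + t *\<^sub>R (x - b) \<in> ball b \<rho>" "b + t *\<^sub>R (x - b) \<in> interior P"
      using e(2)[of t] t vx by (auto simp: vis_iff)
    then have nf: "b + t *\<^sub>R (x - b) \<notin> frontier P" using interior_disjoint by blast
    have co: "A \<bullet> (b + t *\<^sub>R (x - b) - b) = t * (A \<bullet> (x - b))" "B \<bullet> (b + t *\<^sub>R (x - b) - b) = t * (B \<bullet> (x - b))"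
      by simp_all
    consider "A \<bullet> (x - b) > 0" "B \<bullet> (x - b) > 0" | "A \<bullet> (x - b) < 0" | "B \<bullet> (x - b) < 0"
      using nf fr[OF w(1)] t unfolding co by fastforce
    then show ?thesis
    proof cases
      case 1
      then have "b + t *\<^sub>R (x - b) \<in> C" using w t co by (simp add: C_def)
      then show ?thesis using 1 w by blast
    next
      case 2
      then have "b + t *\<^sub>R (x - b) \<in> WA" using w t co by (simp add: WA_def mult_pos_neg)
      then show ?thesis using 2 w by blast
    next
      case 3
      then have "b + t *\<^sub>R (x - b) \<in> WB" using w t co by (simp add: WB_def mult_pos_neg)
      then show ?thesis using 3 w by blast
    qed
  qed
  \<comment> \<open>When one end neighbourhood serves both sight lines from \<open>b\<close>, edge
    points in its closure close to \<open>b\<close> see \<open>p\<close> and \<open>y\<close>, so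
    \<open>p\<close> itself can stay.\<close>
  have direct: ?thesis if W: "end_nbhd b p W" "end_nbhd b y W"
    and e: "e > 0" "\<And>t. 0 < t \<Longrightarrow> t < e \<Longrightarrow> b + t *\<^sub>R v' \<in> E \<and> b + t *\<^sub>R v' \<in> closure W" for W e v'
  proof -
    obtain e5 where e5: "e5 > 0" "\<And>q. q \<in> closure W \<Longrightarrow> dist q b < e5 \<Longrightarrow> vis q p"
      using vis_near[OF p(2) W(1)] by blast
    obtain e6 where e6: "e6 > 0" "\<And>q. q \<in> closure W \<Longrightarrow> dist q b < e6 \<Longrightarrow> vis q y"
      using vis_near[OF y(1) W(2)] by blast
    have "b \<in> ball b (min e5 e6)" using e5 e6 by simp
    then obtain e7 where e7: "e7 > 0" "\<And>t. \<bar>t\<bar> < e7 \<Longrightarrow> b + t *\<^sub>R v' \<in> ball b (min e5 e6)"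
      using small_step by metis
    define t where "t = min e e7 / 2"
    have t: "0 < t" "t < e" "t < e7" using e(1) e7(1) by (auto simp: t_def)
    have "dist (b + t *\<^sub>R v') b < min e5 e6" using e7(2)[of t] t by (simp add: dist_commute)
    then have "vis (b + t *\<^sub>R v') p" "vis (b + t *\<^sub>R v') y" using e5(2) e6(2) e(2)[OF t(1,2)] by auto
    moreover from this have "vis p (b + t *\<^sub>R v')" by (blast intro: vis_sym)
    moreover have "dist p p < \<eta>" using \<eta> by simp
    ultimately show ?thesis using p(1) e(2)[OF t(1,2)] by blast
  qed
  obtain ev where ev: "ev > 0" "\<And>t. 0 < t \<Longrightarrow> t < ev \<Longrightarrow> b + t *\<^sub>R v \<in> E \<and> b + t *\<^sub>R v \<in> ball b \<rho>"
    using corner_edge_points[OF c] by blast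
  obtain eu where eu: "eu > 0" "\<And>t. 0 < t \<Longrightarrow> t < eu \<Longrightarrow> b + t *\<^sub>R u \<in> E \<and> b + t *\<^sub>R u \<in> ball b \<rho>"
    using corner_edge_points[OF corner_swap[OF c]] by blast
  show ?thesis
  proof (cases "C \<subseteq> interior P")
    case True
    then have sgn: "A \<bullet> (x - b) > 0 \<and> B \<bullet> (x - b) > 0" if "vis b x" for x
      using start[OF that] in_both not_both by blast
    have cl: "w \<in> closure C" if w: "w \<in> ball b \<rho>" "A \<bullet> (w - b) \<ge> 0" "B \<bullet> (w - b) \<ge> 0" for w
    proof -
      obtain e where e: "e > 0" "\<And>t. \<bar>t\<bar> < e \<Longrightarrow> w + t *\<^sub>R (u + v) \<in> ball b \<rho>"
        using small_step[OF w(1)] by blast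
      show ?thesis
      proof (rule closure_rayI[OF e(1)])
        fix t :: real assume "0 < t" "t < e"
        then show "w + t *\<^sub>R (u + v) \<in> C" using e(2)[of t] w uv
          by (simp add: C_def inner_right_distrib inner_diff_right)
      qed
    qed
    have "end_nbhd b x C" if x: "vis b x" for x
    proof -
      obtain e where e: "e > 0" "\<And>t. \<bar>t\<bar> < e \<Longrightarrow> b + t *\<^sub>R (x - b) \<in> ball b \<rho>"
        using small_step[OF bb] by blast
      show ?thesis
        by (rule end_nbhdI[OF opC conv(3) True _ e(1)])
          (use e(2) sgn[OF x] cl[OF bb] in \<open>auto simp: C_def\<close>)
    qed
    then show ?thesis using direct[OF _ _ ev(1), of C v] p y ev(2) cl uv by auto
  next
    case False
    then have sgn: "A \<bullet> (x - b) < 0 \<or> B \<bullet> (x - b) < 0" if "vis b x" for x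
      using start[OF that] inC by blast
    have W: "WA \<subseteq> interior P" "WB \<subseteq> interior P"
      using start[OF y] inC in_both False by blast+
    note sideA = corner_side[OF c W(1)[unfolded WA_def], folded WA_def]
    note sideB = corner_side[OF corner_swap[OF c] W(2)[unfolded WB_def], folded WB_def]
    consider "A \<bullet> (p - b) < 0" "A \<bullet> (y - b) < 0" | "B \<bullet> (p - b) < 0" "B \<bullet> (y - b) < 0"
      | "A \<bullet> (p - b) \<ge> 0" "B \<bullet> (p - b) < 0" "A \<bullet> (y - b) < 0"
      | "B \<bullet> (p - b) \<ge> 0" "A \<bullet> (p - b) < 0" "B \<bullet> (y - b) < 0"
      using sgn[OF p(2)] sgn[OF y] by linarith
    then show ?thesis
    proof cases
      case 1
      then show ?thesis using direct[OF sideA(2) sideA(2) ev(1), of v] ev(2) sideA(1) uv by auto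
    next
      case 2
      then show ?thesis using direct[OF sideB(2) sideB(2) eu(1), of u] eu(2) sideB(1) uv by auto
    next
      case 3
      then show ?thesis
        using corner_pivot_opposite[OF c W[unfolded WA_def WB_def] p _ _ y _ \<eta>] by blast
    next
      case 4
      then show ?thesis
        using corner_pivot_opposite[OF corner_swap[OF c] W(2,1)[unfolded WA_def WB_def] p _ _ y _ \<eta>] by blast
    qed
  qed
qed

end

section \<open>Polygons as polygonal regions\<close>

lemma cr_eq_0_imp_multiple:
  assumes "cr d x = 0" "d \<noteq> 0"
  shows "x = ((x \<bullet> d) / (d \<bullet> d)) *\<^sub>R d"
proof -
  have "d \<bullet> d \<noteq> 0" using assms by simp
  have "(d \<bullet> d) *\<^sub>R x = (x \<bullet> d) *\<^sub>R d + cr d x *\<^sub>R (\<i> * d)"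
    by (simp add: complex_eq_iff inner_complex_def cr_def algebra_simps)
  then have "(d \<bullet> d) *\<^sub>R x = (x \<bullet> d) *\<^sub>R d" using assms by simp
  then have "(1 / (d \<bullet> d)) *\<^sub>R ((d \<bullet> d) *\<^sub>R x) = (1 / (d \<bullet> d)) *\<^sub>R ((x \<bullet> d) *\<^sub>R d)" by simp
  then show ?thesis using \<open>d \<bullet> d \<noteq> 0\<close> by simp
qed

text \<open>\<open>K\<close> is the rest of the boundary. Within distance \<open>\<rho>\<close> of
  \<open>z\<close> neither \<open>K\<close> nor an end of the segment is reached, so the segment
  looks like its whole line.\<close>

lemma edge_nbhd_segment:
  assumes z: "z \<in> open_segment a b" and K: "closed K" "z \<notin> K"
  shows "\<exists>\<rho>. edge_nbhd (closed_segment a b \<union> K) z (\<i> * (b - a)) \<rho>"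
proof -
  from z obtain s where s: "0 < s" "s < 1" "z = (1 - s) *\<^sub>R a + s *\<^sub>R b" and ab: "a \<noteq> b"
    by (auto simp: in_segment)
  define d where "d = b - a"
  have d: "d \<noteq> 0" using ab by (simp add: d_def)
  have pt: "(1 - t) *\<^sub>R a + t *\<^sub>R b = a + t *\<^sub>R d" for t by (simp add: d_def algebra_simps)
  have zs: "z = a + s *\<^sub>R d" using s(3) pt by simp
  obtain r where r: "r > 0" "ball z r \<inter> K = {}" using K
    by (meson ComplI disjoint_eq_subset_Compl open_Compl open_contains_ball)
  define \<rho> where "\<rho> = min r (min s (1 - s) * norm d)"
  have "edge_nbhd (closed_segment a b \<union> K) z (\<i> * d) \<rho>" unfolding edge_nbhd_def
  proof (intro conjI ballI)
    show "\<rho> > 0" using r s d by (simp add: \<rho>_def)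
    show "\<i> * d \<noteq> 0" using d by simp
    fix w assume w: "w \<in> ball z \<rho>"
    then have "w \<notin> K" using r by (auto simp: \<rho>_def)
    have i: "(\<i> * d) \<bullet> x = cr d x" for x by (simp add: inner_complex_def cr_def)
    show "w \<in> closed_segment a b \<union> K \<longleftrightarrow> (\<i> * d) \<bullet> (w - z) = 0"
    proof
      assume "w \<in> closed_segment a b \<union> K"
      then obtain t where "w = a + t *\<^sub>R d" using \<open>w \<notin> K\<close> pt by (auto simp: in_segment)
      then have "w - z = (t - s) *\<^sub>R d" by (simp add: zs algebra_simps)
      then show "(\<i> * d) \<bullet> (w - z) = 0" by (simp add: i cr_scaleR_right cr_self)
    next
      assume "(\<i> * d) \<bullet> (w - z) = 0"
      then obtain t where t: "w - z = t *\<^sub>R d" using cr_eq_0_imp_multiple[OF _ d] i by metis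
      have "\<bar>t\<bar> * norm d = norm (w - z)" by (simp add: t)
      also have "\<dots> < min s (1 - s) * norm d" using w by (simp add: \<rho>_def dist_norm norm_minus_commute)
      finally have "\<bar>t\<bar> < min s (1 - s)" using d by (simp add: mult_less_cancel_right)
      then have "0 \<le> s + t" "s + t \<le> 1" by auto
      moreover have "w = a + (s + t) *\<^sub>R d" using t zs by (simp add: algebra_simps)
      ultimately show "w \<in> closed_segment a b \<union> K" using pt by (auto simp: in_segment intro!: exI[of _ "s + t"])
    qed
  qed
  then show ?thesis unfolding d_def by blast
qed

text \<open>Closer to \<open>b\<close> than the lengths of both segments, each looks like a full
  ray, and the radius keeps out the rest \<open>K\<close> of the boundary. The dual basis comes from
  Cramer's rule.\<close>

lemma corner_segments:
  assumes uv: "cr u v \<noteq> 0" and K: "closed K" "b \<notin> K"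
  shows "\<exists>A B \<rho>. corner (closed_segment b (b + u) \<union> closed_segment b (b + v) \<union> K) b A B u v \<rho>"
proof -
  define D where "D = cr u v"
  have D: "D \<noteq> 0" using uv by (simp add: D_def)
  define A where "A = (1 / D) *\<^sub>R Complex (Im v) (- Re v)"
  define B where "B = (1 / D) *\<^sub>R Complex (- Im u) (Re u)"
  have Ax: "A \<bullet> x = cr x v / D" for x
    by (simp add: A_def inner_complex_def cr_def diff_divide_distrib mult.commute)
  have Bx: "B \<bullet> x = cr u x / D" for x
    by (simp add: B_def inner_complex_def cr_def diff_divide_distrib mult.commute)
  have uvv: "A \<bullet> u = 1" "A \<bullet> v = 0" "B \<bullet> u = 0" "B \<bullet> v = 1"
    unfolding Ax Bx using D by (simp_all add: D_def cr_self)
  have rep: "x = (A \<bullet> x) *\<^sub>R u + (B \<bullet> x) *\<^sub>R v" for x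
  proof -
    have "D *\<^sub>R x = cr x v *\<^sub>R u + cr u x *\<^sub>R v"
      by (simp add: complex_eq_iff cr_def D_def algebra_simps)
    then have "(1 / D) *\<^sub>R (D *\<^sub>R x) = (1 / D) *\<^sub>R (cr x v *\<^sub>R u + cr u x *\<^sub>R v)" by simp
    then show ?thesis using D by (simp add: Ax Bx scaleR_right_distrib)
  qed
  have nz: "u \<noteq> 0" "v \<noteq> 0" using uv by (auto simp: cr_def)
  obtain r where r: "r > 0" "ball b r \<inter> K = {}" using K
    by (meson ComplI disjoint_eq_subset_Compl open_Compl open_contains_ball)
  define \<rho> where "\<rho> = min r (min (norm u) (norm v))"
  have seg: "w \<in> closed_segment b (b + u') \<longleftrightarrow> (\<exists>t\<ge>0. w - b = t *\<^sub>R u')"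
    if w: "dist b w < norm u'" "u' \<noteq> 0" for w u'
  proof
    assume "w \<in> closed_segment b (b + u')"
    then show "\<exists>t\<ge>0. w - b = t *\<^sub>R u'" by (auto simp: in_segment algebra_simps)
  next
    assume "\<exists>t\<ge>0. w - b = t *\<^sub>R u'"
    then obtain t where t: "t \<ge> 0" "w - b = t *\<^sub>R u'" by auto
    have "t * norm u' = norm (w - b)" using t by simp
    then have "t * norm u' < 1 * norm u'" using w by (simp add: dist_norm norm_minus_commute)
    then have "t \<le> 1" using w(2) by (simp add: mult_less_cancel_right)
    moreover have "w = (1 - t) *\<^sub>R b + t *\<^sub>R (b + u')" using t(2) by (simp add: algebra_simps)
    ultimately show "w \<in> closed_segment b (b + u')" using t(1) by (auto simp: in_segment)
  qed
  have "corner (closed_segment b (b + u) \<union> closed_segment b (b + v) \<union> K) b A B u v \<rho>"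
    unfolding corner_def
  proof (intro conjI ballI allI)
    show "\<rho> > 0" using r nz by (simp add: \<rho>_def)
    fix w assume w: "w \<in> ball b \<rho>"
    then have "w \<notin> K" using r by (auto simp: \<rho>_def)
    moreover have "w \<in> closed_segment b (b + u) \<longleftrightarrow> A \<bullet> (w - b) \<ge> 0 \<and> B \<bullet> (w - b) = 0"
    proof -
      have "(\<exists>t\<ge>0. w - b = t *\<^sub>R u) \<longleftrightarrow> A \<bullet> (w - b) \<ge> 0 \<and> B \<bullet> (w - b) = 0"
        using rep[of "w - b"] uvv by (metis add.right_neutral inner_scaleR_right mult.right_neutral mult_zero_right scaleR_zero_left)
      then show ?thesis using seg[of w u] w nz by (simp add: \<rho>_def)
    qed
    moreover have "w \<in> closed_segment b (b + v) \<longleftrightarrow> A \<bullet> (w - b) = 0 \<and> B \<bullet> (w - b) \<ge> 0"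
    proof -
      have "(\<exists>t\<ge>0. w - b = t *\<^sub>R v) \<longleftrightarrow> A \<bullet> (w - b) = 0 \<and> B \<bullet> (w - b) \<ge> 0"
        using rep[of "w - b"] uvv by (metis add.left_neutral inner_scaleR_right mult.right_neutral mult_zero_right scaleR_zero_left)
      then show ?thesis using seg[of w v] w nz by (simp add: \<rho>_def)
    qed
    ultimately show "w \<in> closed_segment b (b + u) \<union> closed_segment b (b + v) \<union> K \<longleftrightarrow>
      A \<bullet> (w - b) \<ge> 0 \<and> B \<bullet> (w - b) = 0 \<or> A \<bullet> (w - b) = 0 \<and> B \<bullet> (w - b) \<ge> 0" by blast
  qed (use uvv rep in auto)
  then show ?thesis by blast
qed

lemma collinear_iff_cr: "collinear {a, b, c} \<longleftrightarrow> cr (c - b) (a - b) = 0"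
proof -
  have *: "collinear {a, b, c} \<longleftrightarrow> collinear {0, a - b, c - b}" using collinear_3[of a b c] by (simp add: NO_MATCH_def)
  show ?thesis
  proof
    assume "collinear {a, b, c}"
    then show "cr (c - b) (a - b) = 0" unfolding * collinear_lemma
      by (auto simp: cr_scaleR_left cr_self) (simp_all add: cr_def)
  next
    assume 0: "cr (c - b) (a - b) = 0"
    then have 1: "cr (a - b) (c - b) = 0" by (simp add: cr_def mult.commute)
    show "collinear {a, b, c}" unfolding * collinear_lemma
      using cr_eq_0_imp_multiple[OF 1] by blast
  qed
qed

section \<open>Combinatorics of the boundary cycles\<close>

context
  fixes P cs
  assumes poly: "polygon_with_holes P cs"
begin

lemma poly_cycle: "c \<in> set cs \<Longrightarrow> simple_cycle c"
  using poly by (simp add: polygon_with_holes_def)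

lemma cycles_disjoint:
  assumes "c \<in> set cs" "c' \<in> set cs" "x \<in> cycle_set c" "x \<in> cycle_set c'"
  shows "c = c'"
proof (rule ccontr)
  assume "c \<noteq> c'"
  moreover obtain i j where "i < length cs" "c = cs ! i" "j < length cs" "c' = cs ! j"
    using assms(1,2) by (auto simp: in_set_conv_nth)
  ultimately have "cycle_set c \<inter> cycle_set c' = {}"
    using poly unfolding polygon_with_holes_def by blast
  then show False using assms by blast
qed

lemma poly_edgeE:
  assumes "(a, b) \<in> poly_edges cs"
  obtains c i where "c \<in> set cs" "i < length c" "a = c ! i" "b = c ! ((i + 1) mod length c)"
    "closed_segment a b \<subseteq> cycle_set c"
  using assms unfolding poly_edges_def cycle_edges_def cycle_set_def by fastforce

lemma poly_edge_memberI:
  assumes "c \<in> set cs" "i < length c"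
  shows "(c ! i, c ! ((i + 1) mod length c)) \<in> poly_edges cs"
  using assms unfolding poly_edges_def cycle_edges_def by blast

text \<open>Disjointness of different cycles puts both edges on one cycle, where simplicity
  applies.\<close>

lemma edges_meet_at_endpoints:
  assumes e: "(a, b) \<in> poly_edges cs" "(a', b') \<in> poly_edges cs"
    and x: "x \<in> closed_segment a b" "x \<in> closed_segment a' b'" and ne: "(a, b) \<noteq> (a', b')"
  shows "x \<in> {a, b} \<inter> {a', b'}"
proof -
  obtain c i where c: "c \<in> set cs" "i < length c" "a = c ! i" "b = c ! ((i + 1) mod length c)"
    "closed_segment a b \<subseteq> cycle_set c" using poly_edgeE[OF e(1)] .
  obtain c' j where c': "c' \<in> set cs" "j < length c'" "a' = c' ! j" "b' = c' ! ((j + 1) mod length c')"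
    "closed_segment a' b' \<subseteq> cycle_set c'" using poly_edgeE[OF e(2)] .
  have "c = c'" using cycles_disjoint c(1,5) c'(1,5) x by blast
  then have "i \<noteq> j" using ne c c' by auto
  then have "closed_segment a b \<inter> closed_segment a' b' \<subseteq> {a, b} \<inter> {a', b'}"
    using poly_cycle[OF c(1)] c c' \<open>c = c'\<close> unfolding simple_cycle_def by blast
  then show ?thesis using x by blast
qed

lemma frontier_poly: "frontier P = (\<Union>(a, b) \<in> poly_edges cs. closed_segment a b)"
  using poly unfolding polygon_with_holes_def cycle_set_def poly_edges_def by auto

lemma finite_poly_edges: "finite (poly_edges cs)"
  unfolding poly_edges_def cycle_edges_def by auto

lemma finite_poly_vertices: "finite (poly_vertices cs)"
  unfolding poly_vertices_def by auto

lemma vertex_in_edge: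
  assumes "v \<in> poly_vertices cs"
  obtains c k where "c \<in> set cs" "k < length c" "v = c ! k" "(c ! k, c ! ((k + 1) mod length c)) \<in> poly_edges cs"
proof -
  obtain c k where "c \<in> set cs" "k < length c" "v = c ! k"
    using assms unfolding poly_vertices_def by (auto simp: in_set_conv_nth)
  then show thesis using that poly_edge_memberI by blast
qed

lemma edge_endpoints: "(a, b) \<in> poly_edges cs \<Longrightarrow> a \<in> poly_vertices cs \<and> b \<in> poly_vertices cs"
proof -
  assume "(a, b) \<in> poly_edges cs"
  then obtain c i where c: "c \<in> set cs" "i < length c" "a = c ! i" "b = c ! ((i + 1) mod length c)"
    using poly_edgeE by metis
  then have "(i + 1) mod length c < length c" by (intro mod_less_divisor) auto
  then show ?thesis using c unfolding poly_vertices_def by (auto intro: nth_mem)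
qed

lemma frontier_split: "frontier P = edge_points cs \<union> poly_vertices cs"
proof
  show "frontier P \<subseteq> edge_points cs \<union> poly_vertices cs"
  proof
    fix x assume "x \<in> frontier P"
    then obtain a b where "(a, b) \<in> poly_edges cs" "x \<in> closed_segment a b"
      unfolding frontier_poly by auto
    then show "x \<in> edge_points cs \<union> poly_vertices cs"
      using edge_endpoints[of a b] unfolding edge_points_def open_segment_def by auto
  qed
  have "v \<in> frontier P" if v: "v \<in> poly_vertices cs" for v
  proof -
    obtain c k where "v = c ! k" "(c ! k, c ! ((k + 1) mod length c)) \<in> poly_edges cs"
      using vertex_in_edge[OF v] by metis
    then show ?thesis unfolding frontier_poly
      by (intro UN_I[of "(c ! k, c ! ((k + 1) mod length c))"]) simp_all
  qed
  moreover have "edge_points cs \<subseteq> frontier P"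
    unfolding edge_points_def frontier_poly open_segment_def by auto
  ultimately show "edge_points cs \<union> poly_vertices cs \<subseteq> frontier P" by blast
qed

text \<open>Each vertex starts an edge, and an edge with this vertex as an inner point would meet
  that one away from its own ends.\<close>

lemma edge_points_not_vertices: "edge_points cs \<inter> poly_vertices cs = {}"
proof (rule ccontr)
  assume "\<not> ?thesis"
  then obtain a b v where v: "(a, b) \<in> poly_edges cs" "v \<in> open_segment a b" "v \<in> poly_vertices cs"
    unfolding edge_points_def by auto
  obtain c k where "v = c ! k" "(c ! k, c ! ((k + 1) mod length c)) \<in> poly_edges cs"
    using vertex_in_edge[OF v(3)] by metis
  then show False using edges_meet_at_endpoints[OF v(1), of v "c ! ((k + 1) mod length c)" v] v(2)
    by (auto simp: open_segment_def)
qed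

lemma closed_other_edges: "closed (\<Union>(a, b) \<in> poly_edges cs - X. closed_segment a b)"
  using finite_poly_edges by (intro closed_UN) auto

lemma polygon_edge_nbhd:
  assumes "z \<in> edge_points cs"
  shows "\<exists>n \<rho>. edge_nbhd (frontier P) z n \<rho>"
proof -
  obtain a b where ab: "(a, b) \<in> poly_edges cs" "z \<in> open_segment a b"
    using assms unfolding edge_points_def by auto
  define K where "K = (\<Union>(a, b) \<in> poly_edges cs - {(a, b)}. closed_segment a b)"
  have "z \<notin> K"
  proof
    assume "z \<in> K"
    then obtain a' b' where "(a', b') \<in> poly_edges cs" "z \<in> closed_segment a' b'" "(a, b) \<noteq> (a', b')"
      unfolding K_def by auto
    then show False using edges_meet_at_endpoints[OF ab(1), of a' b' z] ab(2) by (auto simp: open_segment_def)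
  qed
  moreover have "closed K" unfolding K_def by (rule closed_other_edges)
  ultimately obtain \<rho> where "edge_nbhd (closed_segment a b \<union> K) z (\<i> * (b - a)) \<rho>"
    using edge_nbhd_segment[OF ab(2)] by blast
  moreover have "closed_segment a b \<union> K = frontier P" unfolding frontier_poly K_def using ab(1) by auto
  ultimately show ?thesis by auto
qed

text \<open>Distinctness of the vertices leaves exactly two edges at \<open>b\<close>, from its
  predecessor \<open>p\<close> and to its successor \<open>q\<close>; \<open>K\<close> collects the
  others and misses \<open>b\<close>. Noncollinearity makes the two directions independent.\<close>

lemma polygon_corner:
  assumes "b \<in> poly_vertices cs"
  shows "\<exists>A B u v \<rho>. corner (frontier P) b A B u v \<rho>"
proof -
  obtain c k where c: "c \<in> set cs" "k < length c" "b = c ! k"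
    "(c ! k, c ! ((k + 1) mod length c)) \<in> poly_edges cs"
    using vertex_in_edge[OF assms] .
  have simp: "length c \<ge> 3" "distinct c" "\<And>i. i < length c \<Longrightarrow>
      \<not> collinear {c ! i, c ! ((i + 1) mod length c), c ! ((i + 2) mod length c)}"
    using poly_cycle[OF c(1)] unfolding simple_cycle_def by auto
  \<comment> \<open>The cyclic predecessor of \<open>k\<close>, wrapping around at 0.\<close>
  define i where "i = (if k = 0 then length c - 1 else k - 1)"
  have i: "i < length c" "(i + 1) mod length c = k" using c(2) simp(1) by (auto simp: i_def)
  have "(i + 2) mod length c = (k + 1) mod length c"
    using i(2) by (metis add.assoc mod_add_left_eq one_add_one)
  then have nc: "\<not> collinear {c ! i, b, c ! ((k + 1) mod length c)}" using simp(3)[OF i(1)] i(2) c(3) by simp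
  define p where "p = c ! i"
  define q where "q = c ! ((k + 1) mod length c)"
  have pe: "(p, b) \<in> poly_edges cs" "(b, q) \<in> poly_edges cs"
    using poly_edge_memberI[OF c(1) i(1)] i(2) c by (auto simp: p_def q_def)
  have "cr (q - b) (p - b) \<noteq> 0" using nc unfolding collinear_iff_cr p_def q_def .
  define K where "K = (\<Union>(a, b) \<in> poly_edges cs - {(p, b), (b, q)}. closed_segment a b)"
  have "b \<notin> K"
  proof
    assume "b \<in> K"
    then obtain x y where xy: "(x, y) \<in> poly_edges cs" "b \<in> closed_segment x y"
      "(x, y) \<noteq> (p, b)" "(x, y) \<noteq> (b, q)" unfolding K_def by auto
    then obtain c' j where c': "c' \<in> set cs" "j < length c'" "x = c' ! j" "y = c' ! ((j + 1) mod length c')"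
      "closed_segment x y \<subseteq> cycle_set c'" using poly_edgeE by metis
    have "b \<in> cycle_set c"
      unfolding cycle_set_def cycle_edges_def c(3) using c(2) by auto
    then have "c' = c" using cycles_disjoint c'(1,5) c(1) xy(2) by blast
    have "b = x \<or> b = y" using edges_meet_at_endpoints[OF xy(1) pe(2) xy(2)] xy(4) by auto
    then show False
    proof
      assume "b = x"
      then have "j = k" using c' c simp(2) \<open>c' = c\<close> nth_eq_iff_index_eq by metis
      then show False using xy(4) c' \<open>c' = c\<close> \<open>b = x\<close> by (simp add: q_def)
    next
      assume "b = y"
      have "(j + 1) mod length c < length c" using c(2) by (intro mod_less_divisor) auto
      then have "(j + 1) mod length c = k" using \<open>b = y\<close> c' c simp(2) \<open>c' = c\<close> nth_eq_iff_index_eq by metis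
      then have "j = i" using c'(2) \<open>c' = c\<close> unfolding i_def
        by (cases "j + 1 = length c") auto
      then show False using xy(3) c' \<open>c' = c\<close> \<open>b = y\<close> by (simp add: p_def)
    qed
  qed
  moreover have "closed K" unfolding K_def by (rule closed_other_edges)
  ultimately obtain A B \<rho> where
    "corner (closed_segment b (b + (q - b)) \<union> closed_segment b (b + (p - b)) \<union> K) b A B (q - b) (p - b) \<rho>"
    using corner_segments[OF \<open>cr (q - b) (p - b) \<noteq> 0\<close>] by blast
  moreover have "closed_segment b q \<union> closed_segment b p \<union> K = frontier P"
    unfolding frontier_poly K_def closed_segment_commute[of b p] using pe by auto
  ultimately have "corner (frontier P) b A B (q - b) (p - b) \<rho>" by simp
  then show ?thesis by blast
qed

lemma polygonal_region_polygon: "polygonal_region P (edge_points cs) (poly_vertices cs)"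
proof
  show "compact P" "connected (interior P)" "P = closure (interior P)"
    using poly unfolding polygon_with_holes_def by blast+
qed (use frontier_split edge_points_not_vertices finite_poly_vertices polygon_edge_nbhd polygon_corner in auto)

end

section \<open>Reflecting guards\<close>

context
  fixes P cs
  assumes poly: "polygon_with_holes P cs"
begin

interpretation polygonal_region P "edge_points cs" "poly_vertices cs"
  using poly by (rule polygonal_region_polygon)

lemma vis_imp_sees_refl: "vis x y \<Longrightarrow> sees_refl P cs r x y"
  using sees_refl_mono[of P cs 0 x y r] by (simp add: vis_def sees_refl_0 sees_directly_def)

lemma vis_sees_refl_Suc:
  "vis x p \<Longrightarrow> p \<in> edge_points cs \<Longrightarrow> sees_refl P cs r p y \<Longrightarrow> sees_refl P cs (Suc r) x y"
  unfolding sees_refl_Suc vis_def sees_directly_def by blast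

text \<open>The point \<open>p\<close> next to \<open>b\<close> is singled out because it is the one
  that may have to move when \<open>b\<close> is passed.\<close>

definition linked :: "complex \<Rightarrow> complex \<Rightarrow> bool" where
  "linked a b \<longleftrightarrow> (\<exists>p\<in>edge_points cs. vis p b \<and> (vis a p \<or> (\<exists>z\<in>edge_points cs. vis a z \<and> vis z p)))"

text \<open>A chain cannot turn at the vertex \<open>b\<close> itself, since no reflection takes place at a vertex;
  the one or two reflections replacing this turn come from \<open>corner_pivot\<close>.\<close>
lemma linked_imp_sees_refl:
  assumes b: "b \<in> poly_vertices cs" and "linked a b" and y: "sees_directly P b y"
  shows "sees_refl P cs 4 a y"
proof -
  obtain p where p: "p \<in> edge_points cs" "vis p b"
    and ap: "vis a p \<or> (\<exists>z\<in>edge_points cs. vis a z \<and> vis z p)"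
    using assms(2) by (auto simp: linked_def)
  \<comment> \<open>The pivot needs freedom to move \<open>p\<close>, so the way from
    \<open>a\<close> is kept open for all edge points near \<open>p\<close>.\<close>
  have reach: "\<exists>\<eta>>0. \<forall>p'\<in>edge_points cs. dist p' p < \<eta> \<longrightarrow>
      (\<forall>r y. sees_refl P cs r p' y \<longrightarrow> sees_refl P cs (Suc (Suc r)) a y)"
  proof (cases "vis a p")
    case True
    then obtain \<eta> where "\<eta> > 0" "\<And>w. w \<in> edge_points cs \<Longrightarrow> dist w p < \<eta> \<Longrightarrow> vis a w"
      using vis_edge p(1) by metis
    moreover have "sees_refl P cs (Suc (Suc r)) a y"
      if "vis a p'" "p' \<in> edge_points cs" "sees_refl P cs r p' y" for p' r y
      using vis_sees_refl_Suc[OF that] by (rule sees_refl_mono) simp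
    ultimately show ?thesis by blast
  next
    case False
    then obtain z where z: "z \<in> edge_points cs" "vis a z" "vis z p" using ap by blast
    obtain \<eta> where "\<eta> > 0" "\<And>w. w \<in> edge_points cs \<Longrightarrow> dist w p < \<eta> \<Longrightarrow> vis z w"
      using vis_edge[OF z(3) p(1)] by metis
    then show ?thesis using vis_sees_refl_Suc z by meson
  qed
  then obtain \<eta> where \<eta>: "\<eta> > 0" "\<And>p' r y. p' \<in> edge_points cs \<Longrightarrow> dist p' p < \<eta> \<Longrightarrow>
      sees_refl P cs r p' y \<Longrightarrow> sees_refl P cs (Suc (Suc r)) a y" by blast
  show ?thesis
  proof (cases "y = b")
    \<comment> \<open>The pivot does not cover \<open>b\<close> itself, as \<open>vis b b\<close>
      fails; \<open>b\<close> is reached straight from \<open>p\<close>.\<close>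
    case True
    then have "sees_refl P cs 2 p y" using vis_imp_sees_refl p by blast
    then show ?thesis using \<eta>(2)[OF p(1), of 2 y] \<eta>(1) by (simp add: numeral_eq_Suc)
  next
    case False
    then have vy: "vis b y" using y by (simp add: vis_def sees_directly_def)
    obtain p' q where p': "p' \<in> edge_points cs" "dist p' p < \<eta>" and q: "q \<in> edge_points cs" "vis q y"
      and p'q: "vis p' q \<or> (\<exists>z\<in>edge_points cs. vis p' z \<and> vis z q)"
      using corner_pivot[OF b p(1) vis_sym[OF p(2)] vy \<eta>(1)] by blast
    have qy: "sees_refl P cs r q y" for r using vis_imp_sees_refl q by blast
    have "sees_refl P cs (Suc (Suc 0)) p' y"
      using p'q vis_sees_refl_Suc qy q(1) by blast
    then show ?thesis using \<eta>(2)[OF p'] by (simp add: numeral_eq_Suc)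
  qed
qed

text \<open>The edge points seen from \<open>A\<close> and those seen from \<open>G - A\<close>
  cover \<open>edge_points cs\<close> because \<open>G\<close> guards \<open>P\<close>, and neither
  set is empty because each vertex sees some edge point. Connectedness of edge visibility yields a
  common point or a sight line between them.\<close>

lemma guards_linked:
  assumes G: "G \<subseteq> poly_vertices cs" "guards_refl P cs 0 G"
    and A: "A \<subseteq> G" "A \<noteq> {}" "A \<noteq> G"
  shows "\<exists>a\<in>A. \<exists>b\<in>G - A. linked a b"
proof -
  define S where "S H = {z \<in> edge_points cs. \<exists>g\<in>H. vis g z}" for H
  have sub: "edge_points cs \<subseteq> P" "poly_vertices cs \<subseteq> P" using frontier_subset frontier_eq by auto
  have nonempty: "S H \<noteq> {}" if "H \<subseteq> G" "H \<noteq> {}" for H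
    using that sees_edge G(1) sub unfolding S_def by blast
  have "edge_points cs \<subseteq> S A \<union> S (G - A)"
  proof
    fix z assume z: "z \<in> edge_points cs"
    then obtain g where g: "g \<in> G" "sees_directly P g z"
      using G(2) sub unfolding guards_refl_def sees_refl_0 by blast
    have "g \<noteq> z" using g(1) G(1) z disjoint by blast
    then have "vis g z" using g(2) by (simp add: vis_def sees_directly_def)
    then show "z \<in> S A \<union> S (G - A)" using z g(1) by (auto simp: S_def)
  qed
  then have "S A \<union> S (G - A) = edge_points cs" by (auto simp: S_def)
  moreover have "S A \<noteq> {}" "S (G - A) \<noteq> {}" using nonempty A by blast+
  ultimately have "S A \<inter> S (G - A) \<noteq> {} \<or> (\<exists>s\<in>S A. \<exists>t\<in>S (G - A). vis s t)"
    by (rule edge_visibility_connected)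
  then obtain s t where st: "s \<in> S A" "t \<in> S (G - A)" "s = t \<or> vis s t" by auto
  then obtain a b where ab: "a \<in> A" "b \<in> G - A" "vis a s" "vis b t"
    and "s \<in> edge_points cs" "t \<in> edge_points cs" by (auto simp: S_def)
  then have "linked a b" using st(3) vis_sym[OF ab(4)] unfolding linked_def by blast
  then show ?thesis using ab by blast
qed

text \<open>Induction removes the last link: what \<open>h\<close> sees is seen from its predecessor
  with four reflections, and \<open>sees_refl_trans\<close> puts the chain from \<open>g\<close> in
  front without charging for the turn at that vertex.\<close>

lemma linked_path_sees_refl:
  assumes "G \<subseteq> poly_vertices cs" "(g, h) \<in> ({(a, b). linked a b} \<inter> G \<times> G) ^^ i" "sees_directly P h y"
  shows "sees_refl P cs (4 * i) g y"
  using assms(2,3)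
proof (induction i arbitrary: h y)
  case 0
  then show ?case by (simp add: sees_refl_0)
next
  case (Suc i)
  then obtain k where k: "(g, k) \<in> ({(a, b). linked a b} \<inter> G \<times> G) ^^ i" "linked k h" "h \<in> G"
    by auto
  then have "sees_refl P cs 4 k y" using linked_imp_sees_refl assms(1) Suc.prems(2) by blast
  then have "sees_refl P cs (4 * i + 4) g y" using Suc.IH[OF k(1)] by (rule sees_refl_trans[rotated])
  then show ?case by (simp add: add.commute)
qed

lemma reflecting_guards:
  assumes G: "G \<subseteq> poly_vertices cs" "guards_refl P cs 0 G"
  shows "\<exists>D. D \<subseteq> G \<and> card D * (r div 4 + 1) \<le> card G + r div 4 \<and> guards_refl P cs r D"
proof -
  define d where "d = r div 4"
  have "poly_vertices cs \<noteq> {}"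
  proof -
    obtain c where "c \<in> set cs" "simple_cycle c"
      using poly unfolding polygon_with_holes_def by (meson list.set_sel(1))
    then show ?thesis unfolding poly_vertices_def simple_cycle_def by fastforce
  qed
  then have "P \<noteq> {}" using frontier_subset frontier_eq by blast
  then have "G \<noteq> {}" using G(2) unfolding guards_refl_def by blast
  moreover have "finite G" using finV G(1) by (rule finite_subset[rotated])
  ultimately have "\<exists>D. D \<subseteq> G \<and> card D * (d + 1) \<le> card G + d \<and>
      (\<forall>x\<in>G. \<exists>g\<in>D. \<exists>i\<le>d. (g, x) \<in> ({(a, b). linked a b} \<inter> G \<times> G) ^^ i)"
    using guards_linked[OF G] by (intro connected_domination) simp_all
  then obtain D where D: "D \<subseteq> G" "card D * (d + 1) \<le> card G + d"
    "\<forall>x\<in>G. \<exists>g\<in>D. \<exists>i\<le>d. (g, x) \<in> ({(a, b). linked a b} \<inter> G \<times> G) ^^ i"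
    by (elim exE conjE)
  have "\<exists>g\<in>D. sees_refl P cs r g y" if y: "y \<in> P" for y
  proof -
    obtain h where h: "h \<in> G" "sees_directly P h y"
      using G(2) y unfolding guards_refl_def sees_refl_0 by blast
    obtain g i where g: "g \<in> D" "i \<le> d" "(g, h) \<in> ({(a, b). linked a b} \<inter> G \<times> G) ^^ i"
      using D(3) h(1) by blast
    have "4 * i \<le> r" using g(2) by (simp add: d_def)
    then have "sees_refl P cs r g y"
      by (rule sees_refl_mono[OF linked_path_sees_refl[OF G(1) g(3) h(2)]])
    then show ?thesis using g(1) by blast
  qed
  then show ?thesis using D unfolding guards_refl_def d_def by blast
qed

end

theorem theorem1:
  fixes P :: "complex set" and cs :: "complex list list" and r \<alpha> :: nat and G :: "complex set"
  assumes "polygon_with_holes P cs"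
    and "G \<subseteq> poly_vertices cs" and "card G = \<alpha>"
    and "guards_refl P cs 0 G"
  shows "\<exists>G'. G' \<subseteq> poly_vertices cs \<and>
           card G' \<le> nat \<lceil>real \<alpha> / real (1 + r div 4)\<rceil> \<and>
           guards_refl P cs r G'"
proof -
  define d where "d = r div 4"
  obtain D where D: "D \<subseteq> G" "card D * (d + 1) \<le> \<alpha> + d" "guards_refl P cs r D"
    using reflecting_guards[OF assms(1,2,4), of r] assms(3) unfolding d_def by auto
  define c where "c = nat \<lceil>real \<alpha> / real (1 + d)\<rceil>"
  have "real \<alpha> / real (1 + d) \<le> real c" unfolding c_def by (rule real_nat_ceiling_ge)
  then have "real \<alpha> \<le> real c * real (1 + d)" by (simp add: divide_le_eq)
  then have "\<alpha> \<le> c * (1 + d)" by (simp only: of_nat_mult[symmetric] of_nat_le_iff)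
  \<comment> \<open>\<open>\<alpha>\<close> is at most \<open>c * (d + 1)\<close> and
    \<open>d\<close> is below \<open>d + 1\<close>; strictness then brings \<open>card D\<close>
    down to the ceiling \<open>c\<close>.\<close>
  then have "card D * (d + 1) < (c + 1) * (d + 1)" using D(2) by (simp add: algebra_simps)
  then have "card D \<le> c" by (simp only: mult_less_cancel2) simp
  then show ?thesis using D assms(2) unfolding c_def d_def by blast
qed

end
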